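(* Let $X$ be a proper $\mathrm{CAT}(0)$ space with a block decomposition $\mathcal{B}$, and let $\mathcal{W}$ be its collection of walls. Suppose that (1) for each $B\in\mathcal{B}$, $\partial B$ is path connected; (2) for each $W\in\mathcal{W}$, $\partial W$ is non-empty; and (3) all irrational rays are lonely. Then the visual boundary $\partial X$ is path connected.
   Context: The visual boundary $\partial X$ is the set of asymptote classes of geodesic rays with the cone topology; for a closed convex $C\subset X$, $\partial C\subset\partial X$ denotes its visual boundary. A block decomposition of a $\mathrm{CAT}(0)$ space $X$ is a collection $\mathcal{B}$ of closed, convex subsets (blocks) such that: (i) $X=\bigcup_{B\in\mathcal{B}}B$; (ii) each block intersects at least two other blocks; (iii) every block has a parity $(+)$ or $(-)$ such that two blocks intersect only if they have opposite parity; (iv) there is $\epsilon>0$ such that two blocks intersect if and only if their $\epsilon$-neighborhoods intersect. A wall is a non-empty intersection of two distinct blocks; $\mathcal{W}$ is the collection of walls. Fix a basepoint $x_0$ not in any wall. A ray $c$ enters a block $B$ if for some $t$, $c(t)\in B$ and $c(t)$ is in no other block. The itinerary of a ray $c$ based at $x_0$ is the sequence of blocks it enters; the itinerary of $\alpha\in\partial X$ is that of the ray based at $x_0$ representing $\alpha$. A point $\alpha$ (or a ray representing it) is irrational if its itinerary is infinite, and rational otherwise. An irrational $\alpha$ is lonely if it is the only point of $\partial X$ with its itinerary. *)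

theory Defs
  imports "HOL-Analysis.Analysis"
begin

section \<open>Proper CAT(0) spaces\<close>

definition geodesic_from_to :: "(real \<Rightarrow> 'a::metric_space) \<Rightarrow> 'a \<Rightarrow> 'a \<Rightarrow> bool" where
  "geodesic_from_to c x y \<longleftrightarrow> c 0 = x \<and> c (dist x y) = y \<and>
     (\<forall>s\<in>{0..dist x y}. \<forall>t\<in>{0..dist x y}. dist (c s) (c t) = \<bar>s - t\<bar>)"

definition geodesic_segments :: "'a::metric_space \<Rightarrow> 'a \<Rightarrow> 'a set set" where
  "geodesic_segments x y = {c ` {0..dist x y} | c. geodesic_from_to c x y}"

definition geodesically_convex :: "'a::metric_space set \<Rightarrow> bool" where
  "geodesically_convex C \<longleftrightarrow> (\<forall>x\<in>C. \<forall>y\<in>C. \<forall>S\<in>geodesic_segments x y. S \<subseteq> C)"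

text \<open>For a geodesic triangle with vertices \<open>x, y, z\<close> and sides \<open>P\<close> (from \<open>x\<close> to \<open>y\<close>),
  \<open>Q\<close> (from \<open>y\<close> to \<open>z\<close>), \<open>R\<close> (from \<open>z\<close> to \<open>x\<close>), and a triangle \<open>x', y', z'\<close> in the
  Euclidean plane with the same side lengths: the pairs consisting of a point of the geodesic
  triangle and a comparison point for it.\<close>

definition comparison_pairs ::
    "'a::metric_space \<Rightarrow> 'a \<Rightarrow> 'a \<Rightarrow> 'a set \<Rightarrow> 'a set \<Rightarrow> 'a set \<Rightarrow>
     real^2 \<Rightarrow> real^2 \<Rightarrow> real^2 \<Rightarrow> ('a \<times> (real^2)) set" where
  "comparison_pairs x y z P Q R x' y' z' =
     {(p, p'). p \<in> P \<and> p' \<in> closed_segment x' y' \<and> dist x' p' = dist x p} \<union>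
     {(p, p'). p \<in> Q \<and> p' \<in> closed_segment y' z' \<and> dist y' p' = dist y p} \<union>
     {(p, p'). p \<in> R \<and> p' \<in> closed_segment z' x' \<and> dist z' p' = dist z p}"

text \<open>The metric space is the whole type, here and below, so that a type argument plays the role of
  the space \<open>X\<close>.\<close>

definition CAT0_space :: "'a::metric_space itself \<Rightarrow> bool" where
  "CAT0_space (_ :: 'a itself) \<longleftrightarrow>
     (\<forall>x y :: 'a. geodesic_segments x y \<noteq> {}) \<and>
     (\<forall>x y z :: 'a. \<forall>P \<in> geodesic_segments x y. \<forall>Q \<in> geodesic_segments y z.
        \<forall>R \<in> geodesic_segments z x. \<forall>x' y' z' :: real^2.
          dist x' y' = dist x y \<longrightarrow> dist y' z' = dist y z \<longrightarrow> dist z' x' = dist z x \<longrightarrow>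
          (\<forall>(p, p') \<in> comparison_pairs x y z P Q R x' y' z'.
           \<forall>(q, q') \<in> comparison_pairs x y z P Q R x' y' z'. dist p q \<le> dist p' q'))"

definition proper_metric_space :: "'a::metric_space itself \<Rightarrow> bool" where
  "proper_metric_space (_ :: 'a itself) \<longleftrightarrow> (\<forall>(x :: 'a) r. compact (cball x r))"


section \<open>The visual boundary\<close>

text \<open>A ray is a function on all of \<open>real\<close> of which only the restriction to \<open>{0..}\<close> is
  meaningful. Rays agreeing on \<open>{0..}\<close> are asymptotic, so the values at negative arguments do not
  affect the asymptote classes.\<close>

definition geodesic_ray :: "(real \<Rightarrow> 'a::metric_space) \<Rightarrow> bool" where
  "geodesic_ray c \<longleftrightarrow> (\<forall>s\<ge>0. \<forall>t\<ge>0. dist (c s) (c t) = \<bar>s - t\<bar>)"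

definition asymptotic_rel :: "((real \<Rightarrow> 'a::metric_space) \<times> (real \<Rightarrow> 'a)) set" where
  "asymptotic_rel = {(c, c'). geodesic_ray c \<and> geodesic_ray c' \<and>
     (\<exists>K. \<forall>t\<ge>0. dist (c t) (c' t) \<le> K)}"

lemma equiv_asymptotic_rel:
  "equiv {c :: real \<Rightarrow> 'a::metric_space. geodesic_ray c} asymptotic_rel"
proof (rule equivI)
  show "asymptotic_rel \<subseteq> {c. geodesic_ray c} \<times> {c :: real \<Rightarrow> 'a. geodesic_ray c}"
    by (auto simp: asymptotic_rel_def)
  show "refl_on {c :: real \<Rightarrow> 'a. geodesic_ray c} asymptotic_rel"
    by (auto simp: refl_on_def asymptotic_rel_def)
  show "sym (asymptotic_rel :: ((real \<Rightarrow> 'a) \<times> _) set)"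
    by (auto simp: sym_def asymptotic_rel_def dist_commute)
  show "trans (asymptotic_rel :: ((real \<Rightarrow> 'a) \<times> _) set)"
  proof (rule transI)
    fix a b c :: "real \<Rightarrow> 'a"
    assume ab: "(a, b) \<in> asymptotic_rel" and bc: "(b, c) \<in> asymptotic_rel"
    from ab obtain K where K: "\<And>t. t \<ge> 0 \<Longrightarrow> dist (a t) (b t) \<le> K"
      by (auto simp: asymptotic_rel_def)
    from bc obtain L where L: "\<And>t. t \<ge> 0 \<Longrightarrow> dist (b t) (c t) \<le> L"
      by (auto simp: asymptotic_rel_def)
    have "dist (a t) (c t) \<le> K + L" if "t \<ge> 0" for t
      using dist_triangle[of "a t" "c t" "b t"] K[OF that] L[OF that] by linarith
    then show "(a, c) \<in> asymptotic_rel"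
      using ab bc by (auto simp: asymptotic_rel_def)
  qed
qed

definition visual_boundary :: "(real \<Rightarrow> 'a::metric_space) set set" where
  "visual_boundary = {c. geodesic_ray c} // asymptotic_rel"

text \<open>The boundary of a closed convex subset, as a subset of the boundary of the whole space.\<close>

definition boundary_of :: "'a::metric_space set \<Rightarrow> (real \<Rightarrow> 'a) set set" where
  "boundary_of C = {\<alpha> \<in> visual_boundary. \<exists>c\<in>\<alpha>. c ` {0..} \<subseteq> C}"

text \<open>The trace on the boundary of the basic cone neighbourhood \<open>U(c, r, \<epsilon>)\<close>.\<close>

definition cone_nhd :: "(real \<Rightarrow> 'a::metric_space) \<Rightarrow> real \<Rightarrow> real \<Rightarrow> (real \<Rightarrow> 'a) set set" where
  "cone_nhd c r \<epsilon> =
     {\<alpha> \<in> visual_boundary. \<exists>c'\<in>\<alpha>. c' 0 = c 0 \<and> dist (c' r) (c r) < \<epsilon>}"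

text \<open>The cone topology seen from the basepoint \<open>x0\<close>. In a complete CAT(0) space it does not
  depend on \<open>x0\<close>, and its underlying set is the whole of \<open>visual_boundary\<close>.\<close>

definition cone_topology :: "'a::metric_space \<Rightarrow> (real \<Rightarrow> 'a) set topology" where
  "cone_topology x0 = topology_generated_by
     {cone_nhd c r \<epsilon> | c r \<epsilon>. geodesic_ray c \<and> c 0 = x0 \<and> 0 < r \<and> 0 < \<epsilon>}"


section \<open>Block decompositions and itineraries\<close>

definition block_decomposition :: "'a::metric_space set set \<Rightarrow> bool" where
  "block_decomposition \<B> \<longleftrightarrow>
     (\<forall>B\<in>\<B>. closed B \<and> geodesically_convex B) \<and>
     \<Union>\<B> = UNIV \<and>
     (\<forall>B\<in>\<B>. \<exists>B1\<in>\<B> - {B}. \<exists>B2\<in>\<B> - {B}. B1 \<noteq> B2 \<and> B \<inter> B1 \<noteq> {} \<and> B \<inter> B2 \<noteq> {}) \<and>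
     (\<exists>parity :: 'a set \<Rightarrow> bool. \<forall>B\<in>\<B>. \<forall>B'\<in>\<B>. B \<noteq> B' \<longrightarrow> B \<inter> B' \<noteq> {} \<longrightarrow> parity B \<noteq> parity B') \<and>
     (\<exists>\<epsilon>>0. \<forall>B\<in>\<B>. \<forall>B'\<in>\<B>. B \<noteq> B' \<longrightarrow>
        (B \<inter> B' \<noteq> {} \<longleftrightarrow> (\<Union>x\<in>B. ball x \<epsilon>) \<inter> (\<Union>x\<in>B'. ball x \<epsilon>) \<noteq> {}))"

definition walls :: "'a set set \<Rightarrow> 'a set set" where
  "walls \<B> = {B \<inter> B' | B B'. B \<in> \<B> \<and> B' \<in> \<B> \<and> B \<noteq> B' \<and> B \<inter> B' \<noteq> {}}"

definition times_only_in :: "'a set set \<Rightarrow> (real \<Rightarrow> 'a) \<Rightarrow> 'a set \<Rightarrow> real set" where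
  "times_only_in \<B> c B = {t. 0 \<le> t \<and> c t \<in> B \<and> (\<forall>B'\<in>\<B> - {B}. c t \<notin> B')}"

definition enters :: "'a set set \<Rightarrow> (real \<Rightarrow> 'a) \<Rightarrow> 'a set \<Rightarrow> bool" where
  "enters \<B> c B \<longleftrightarrow> B \<in> \<B> \<and> times_only_in \<B> c B \<noteq> {}"

definition entered_before :: "'a set set \<Rightarrow> (real \<Rightarrow> 'a) \<Rightarrow> 'a set \<Rightarrow> 'a set set" where
  "entered_before \<B> c B =
     {B'\<in>\<B> - {B}. \<exists>s \<in> times_only_in \<B> c B'. \<exists>t \<in> times_only_in \<B> c B. s < t}"

definition nth_entered :: "'a set set \<Rightarrow> (real \<Rightarrow> 'a) \<Rightarrow> nat \<Rightarrow> 'a set \<Rightarrow> bool" where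
  "nth_entered \<B> c n B \<longleftrightarrow>
     enters \<B> c B \<and> finite (entered_before \<B> c B) \<and> card (entered_before \<B> c B) = n"

text \<open>The itinerary is the finite or infinite sequence of the blocks entered, in order of time;
  a finite sequence is continued by \<open>None\<close>. For a geodesic ray and a block decomposition, convexity
  of the blocks makes \<open>entered_before\<close> a strict linear order on the entered blocks (no block is
  re-entered after another one has been entered). In a proper space a bounded piece of a ray
  meets only finitely many blocks, as blocks of equal parity are uniformly separated. So each
  entered block occurs in the sequence, exactly once.\<close>

definition itinerary :: "'a set set \<Rightarrow> (real \<Rightarrow> 'a) \<Rightarrow> nat \<Rightarrow> 'a set option" where
  "itinerary \<B> c n =
     (if \<exists>B. nth_entered \<B> c n B then Some (THE B. nth_entered \<B> c n B) else None)"

text \<open>In a complete CAT(0) space the ray from \<open>x0\<close> representing \<open>\<alpha>\<close> exists and is unique on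
  \<open>{0..}\<close>. The choice operator only selects its irrelevant values at negative arguments.\<close>

definition ray_from :: "'a::metric_space \<Rightarrow> (real \<Rightarrow> 'a) set \<Rightarrow> real \<Rightarrow> 'a" where
  "ray_from x0 \<alpha> = (SOME c. c \<in> \<alpha> \<and> c 0 = x0)"

definition boundary_itinerary ::
    "'a::metric_space set set \<Rightarrow> 'a \<Rightarrow> (real \<Rightarrow> 'a) set \<Rightarrow> nat \<Rightarrow> 'a set option" where
  "boundary_itinerary \<B> x0 \<alpha> = itinerary \<B> (ray_from x0 \<alpha>)"

definition irrational :: "'a::metric_space set set \<Rightarrow> 'a \<Rightarrow> (real \<Rightarrow> 'a) set \<Rightarrow> bool" where
  "irrational \<B> x0 \<alpha> \<longleftrightarrow> (\<forall>n. boundary_itinerary \<B> x0 \<alpha> n \<noteq> None)"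

definition lonely :: "'a::metric_space set set \<Rightarrow> 'a \<Rightarrow> (real \<Rightarrow> 'a) set \<Rightarrow> bool" where
  "lonely \<B> x0 \<alpha> \<longleftrightarrow>
     (\<forall>\<beta>\<in>visual_boundary. boundary_itinerary \<B> x0 \<beta> = boundary_itinerary \<B> x0 \<alpha> \<longrightarrow> \<beta> = \<alpha>)"

end

(*
  Let R be the block containing x0. Every block B other than R is entered, by all geodesics from x0
  to points of B, from one and the same neighbouring block, its parent: the block of entry depends
  locally constantly on the endpoint, and B is connected. This replaces the usual argument that the
  nerve of the blocks is a tree. The itinerary of an irrational ray is therefore a sequence
  B_0 = R, B_1, B_2, ... in which each B_n is the parent of B_(n+1), and the geodesics from x0 to
  points of B_n meet only blocks among B_0, ..., B_n outside the walls.

  Rational points lie in block boundaries, and the union of these is path connected, since X is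
  connected and intersecting blocks share the boundary points of their wall. Let A be irrational.
  If the boundaries of the B_n converge to A, then paths in them, concatenated infinitely often,
  end in A. Otherwise they accumulate at some A' distinct from A. If A' were irrational, it would
  have the itinerary of A, against loneliness; so A' is rational. Finally A and A' are joined by a
  path: B_n contains points far out in directions close to A and to A', and their directions can be
  joined to that of the point of B_n nearest to x0 by curves that are Lipschitz uniformly in n.
*)

theory Submission
  imports Defs
begin

subsection \<open>Geodesics in proper CAT(0) spaces\<close>

text \<open>The comparison axiom enters only through Stewart's inequality for a vertex and a point
  of the opposite side; it yields the contraction of geodesics toward a common origin, on which all
  estimates rest. The delicate case is that of block boundaries that do not converge to A. Paths
  inside the boundaries of the \<open>B_n\<close> may have no common modulus of continuity, so their
  limits need not be paths. The substitute is the radial projection of the segment from the nearest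
  point \<open>m\<close> of \<open>B_n\<close> to a point \<open>v\<close> at the same distance
  \<open>h\<close> from \<open>x0\<close>. The angle at \<open>m\<close> is not acute, which bounds
  the segment by \<open>sqrt 2 * h < 2 * h\<close> and keeps it away from \<open>x0\<close> in
  proportion to \<open>h\<close>; hence the Lipschitz constant of its projection to radius
  \<open>r\<close> depends on \<open>r\<close> alone. Limits are taken along a filter given by
  Tychonoff's theorem, for all radii and curve parameters at once. Itineraries are read off points
  that lie in a single block. This is an open condition, so whatever a limit ray enters is also
  entered by the geodesics that approximate it, and the order of the blocks is recovered from the
  parents.\<close>

lemma dist_real2: "dist (x :: real^2) y = sqrt ((x$1 - y$1)\<^sup>2 + (x$2 - y$2)\<^sup>2)"
  by (simp add: dist_vec_def L2_set_def sum_2 dist_real_def)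

lemma comparison_triangle_exists:
  fixes a b c :: real
  assumes "0 \<le> a" "0 < b" "0 \<le> c" "a \<le> b + c" "b \<le> a + c" "c \<le> a + b"
  obtains x y z :: "real^2" where "dist x y = a" "dist y z = b" "dist z x = c"
proof -
  \<comment> \<open>Law of cosines: with \<open>y\<close> at the origin and
    \<open>z = (b, 0)\<close>, \<open>u\<close> is the first coordinate of \<open>x\<close>. The
    triangle inequalities amount to \<open>\<bar>u\<bar> \<le> a\<close>, so that the height
    \<open>v\<close> is real.\<close>
  define u where "u = (a\<^sup>2 + b\<^sup>2 - c\<^sup>2) / (2 * b)"
  define v where "v = sqrt (a\<^sup>2 - u\<^sup>2)"
  have 1: "2 * b * u = a\<^sup>2 + b\<^sup>2 - c\<^sup>2"
    using assms by (simp add: u_def)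
  have "(a - b)\<^sup>2 \<le> c\<^sup>2"
    by (rule abs_le_square_iff[THEN iffD1]) (use assms in auto)
  then have "2 * b * u \<le> 2 * b * a"
    unfolding 1 by (simp add: power2_eq_square algebra_simps)
  then have ua: "u \<le> a"
    using assms by simp
  have "c\<^sup>2 \<le> (a + b)\<^sup>2"
    by (rule power_mono) (use assms in auto)
  then have "2 * b * (- a) \<le> 2 * b * u"
    unfolding 1 by (simp add: power2_eq_square algebra_simps)
  then have "- a \<le> u"
    using assms by (subst (asm) mult_le_cancel_left_pos) auto
  with ua have "u\<^sup>2 \<le> a\<^sup>2"
    by (intro abs_le_square_iff[THEN iffD1]) (use assms in auto)
  then have v: "v\<^sup>2 = a\<^sup>2 - u\<^sup>2"
    by (simp add: v_def)
  have "(b - u)\<^sup>2 + v\<^sup>2 = c\<^sup>2"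
    unfolding v using 1 by (simp add: power2_eq_square algebra_simps)
  moreover have "u\<^sup>2 + v\<^sup>2 = a\<^sup>2"
    unfolding v by simp
  ultimately show ?thesis
    using assms
    by (intro that[of "vector [u, v]" 0 "vector [b, 0]"]) (simp_all add: dist_real2)
qed

lemma euclidean_stewart:
  fixes x y z :: "'b::real_inner"
  shows "(dist x ((1 - l) *\<^sub>R y + l *\<^sub>R z))\<^sup>2 =
    (1 - l) * (dist x y)\<^sup>2 + l * (dist x z)\<^sup>2 - l * (1 - l) * (dist y z)\<^sup>2"
  unfolding dist_norm power2_norm_eq_inner
  by (simp add: inner_diff_left inner_diff_right inner_add_left inner_add_right inner_commute
      algebra_simps power2_eq_square)

text \<open>The point of the geodesic from \<open>x\<close> to \<open>y\<close> at distance \<open>t\<close> from \<open>x\<close>, and \<open>y\<close> itself once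
  \<open>t\<close> exceeds the length.\<close>

definition toward :: "'a::metric_space \<Rightarrow> 'a \<Rightarrow> real \<Rightarrow> 'a" where
  "toward x y t = (SOME w. dist x w = min t (dist x y) \<and> dist w y = dist x y - min t (dist x y))"

locale proper_CAT0 =
  fixes X :: "'a::metric_space itself"
  assumes proper: "proper_metric_space X"
    and CAT0: "CAT0_space X"
begin

lemma compact_cball: "compact (cball (x::'a) r)"
  using proper by (auto simp: proper_metric_space_def)

lemma geodesic_exists: "\<exists>c. geodesic_from_to c (x::'a) y"
  using CAT0 by (fastforce simp: CAT0_space_def geodesic_segments_def)

text \<open>The only use of the comparison condition, for a vertex and a point of the opposite side;
  the comparison distance is evaluated exactly by \<open>euclidean_stewart\<close>.\<close>

lemma stewart_on_geodesic:
  fixes x y z w :: 'a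
  assumes c: "geodesic_from_to c y z" and l: "0 \<le> l" "l \<le> 1" and w: "w = c (l * dist y z)"
  shows "(dist x w)\<^sup>2 \<le> (1 - l) * (dist x y)\<^sup>2 + l * (dist x z)\<^sup>2 - l * (1 - l) * (dist y z)\<^sup>2"
proof (cases "y = z")
  case True
  then have "w = y"
    using c w by (simp add: geodesic_from_to_def)
  then show ?thesis
    using True by (simp add: algebra_simps)
next
  case False
  obtain x' y' z' :: "real^2"
    where d: "dist x' y' = dist x y" "dist y' z' = dist y z" "dist z' x' = dist z x"
  proof (rule comparison_triangle_exists[of "dist x y" "dist y z" "dist z x"])
    show "dist x y \<le> dist y z + dist z x"
      using dist_triangle[of x y z] by (simp add: dist_commute)
    show "dist y z \<le> dist x y + dist z x"
      using dist_triangle[of y z x] by (simp add: dist_commute)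
    show "dist z x \<le> dist x y + dist y z"
      using dist_triangle[of z x y] by (simp add: dist_commute)
  qed (use False in auto)
  obtain c1 c2 where c12: "geodesic_from_to c1 x y" "geodesic_from_to c2 z x"
    using geodesic_exists by metis
  let ?P = "c1 ` {0..dist x y}" and ?Q = "c ` {0..dist y z}" and ?R = "c2 ` {0..dist z x}"
  have seg: "?P \<in> geodesic_segments x y" "?Q \<in> geodesic_segments y z" "?R \<in> geodesic_segments z x"
    using c c12 by (auto simp: geodesic_segments_def)
  define w' where "w' = (1 - l) *\<^sub>R y' + l *\<^sub>R z'"
  have lm: "l * dist y z \<in> {0..dist y z}"
    using l by (auto simp: mult_left_le_one_le)
  have "dist y w = l * dist y z"
  proof -
    have "dist (c 0) (c (l * dist y z)) = \<bar>0 - l * dist y z\<bar>"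
      using c lm unfolding geodesic_from_to_def by (metis atLeastAtMost_iff order_refl zero_le_dist)
    then show ?thesis
      using c w l by (simp add: geodesic_from_to_def abs_mult)
  qed
  moreover have "dist y' w' = l * dist y z"
  proof -
    have "y' - w' = l *\<^sub>R (y' - z')"
      by (simp add: w'_def algebra_simps)
    then show ?thesis
      using l d by (simp add: dist_norm)
  qed
  ultimately have pw: "(w, w') \<in> comparison_pairs x y z ?P ?Q ?R x' y' z'"
    using w lm l by (auto simp: comparison_pairs_def w'_def in_segment)
  have "c1 0 = x"
    using c12 by (simp add: geodesic_from_to_def)
  then have "x \<in> ?P"
    by (metis atLeastAtMost_iff image_eqI order_refl zero_le_dist)
  then have px: "(x, x') \<in> comparison_pairs x y z ?P ?Q ?R x' y' z'"
    by (auto simp: comparison_pairs_def)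
  have "\<forall>(p, p') \<in> comparison_pairs x y z ?P ?Q ?R x' y' z'.
        \<forall>(q, q') \<in> comparison_pairs x y z ?P ?Q ?R x' y' z'. dist p q \<le> dist p' q'"
    using CAT0 seg d unfolding CAT0_space_def by blast
  then have "dist x w \<le> dist x' w'"
    using px pw by blast
  then have "(dist x w)\<^sup>2 \<le> (dist x' w')\<^sup>2"
    by (simp add: power_mono)
  then show ?thesis
    unfolding w'_def euclidean_stewart using d by (simp add: dist_commute)
qed

lemma geodesic_from_to_dist:
  assumes "geodesic_from_to c x y" "0 \<le> t" "t \<le> dist x y"
  shows "dist x (c t) = t" "dist (c t) y = dist x y - t"
proof -
  have "dist (c 0) (c t) = \<bar>0 - t\<bar>" "dist (c t) (c (dist x y)) = \<bar>t - dist x y\<bar>"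
    using assms unfolding geodesic_from_to_def by (metis atLeastAtMost_iff order_refl zero_le_dist)+
  then show "dist x (c t) = t" "dist (c t) y = dist x y - t"
    using assms by (auto simp: geodesic_from_to_def)
qed

text \<open>Stewart's inequality applied to a second candidate point has right-hand side \<open>0\<close>.\<close>

lemma geodesic_point_unique:
  fixes y z w :: 'a
  assumes c: "geodesic_from_to c y z" and w: "dist y w + dist w z = dist y z"
  shows "w = c (dist y w)"
proof (cases "y = z")
  case True
  then show ?thesis
    using assms by (simp add: geodesic_from_to_def dist_commute add_nonneg_eq_0_iff)
next
  case False
  define l where "l = dist y w / dist y z"
  have l: "0 \<le> l" "l \<le> 1" "dist y w = l * dist y z"
    using False w unfolding l_def
    by (auto simp: divide_simps) (metis le_add_same_cancel1 zero_le_dist)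
  have "dist w z = (1 - l) * dist y z"
    using w l by (simp add: algebra_simps)
  then have "(dist w (c (l * dist y z)))\<^sup>2 \<le> (1 - l) * (l * dist y z)\<^sup>2 + l * ((1 - l) * dist y z)\<^sup>2
      - l * (1 - l) * (dist y z)\<^sup>2"
    using stewart_on_geodesic[OF c l(1,2) refl, of w] l by (simp add: dist_commute)
  also have "\<dots> = 0"
    by (simp add: power2_eq_square algebra_simps)
  finally show ?thesis
    using l by simp
qed

text \<open>As geodesics are unique, two distances determine the point \<open>w\<close>, and later
  arguments need no parametrisation.\<close>

lemma stewart:
  fixes x y z w :: 'a
  assumes l: "0 \<le> l" "l \<le> 1" and w: "dist y w = l * dist y z" "dist w z = (1 - l) * dist y z"
  shows "(dist x w)\<^sup>2 \<le> (1 - l) * (dist x y)\<^sup>2 + l * (dist x z)\<^sup>2 - l * (1 - l) * (dist y z)\<^sup>2"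
proof -
  obtain c where c: "geodesic_from_to c y z"
    using geodesic_exists by blast
  have "w = c (l * dist y z)"
    using geodesic_point_unique[OF c, of w] w by (simp add: algebra_simps)
  then show ?thesis
    using stewart_on_geodesic[OF c l] by blast
qed

section \<open>Points at a prescribed distance along a geodesic\<close>

lemma dist_toward:
  fixes x y :: 'a
  assumes "0 \<le> t"
  shows "dist x (toward x y t) = min t (dist x y)"
    and "dist (toward x y t) y = dist x y - min t (dist x y)"
proof -
  obtain c where c: "geodesic_from_to c x y"
    using geodesic_exists by blast
  have "\<exists>w. dist x w = min t (dist x y) \<and> dist w y = dist x y - min t (dist x y)"
    using geodesic_from_to_dist[OF c, of "min t (dist x y)"] assms
    by (intro exI[of _ "c (min t (dist x y))"]) auto
  from someI_ex[OF this] show "dist x (toward x y t) = min t (dist x y)"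
    and "dist (toward x y t) y = dist x y - min t (dist x y)"
    unfolding toward_def by auto
qed

lemma toward_unique:
  fixes x y w :: 'a
  assumes "dist x w + dist w y = dist x y"
  shows "toward x y (dist x w) = w"
proof -
  obtain c where c: "geodesic_from_to c x y"
    using geodesic_exists by blast
  have *: "dist x w \<le> dist x y"
    using assms by (metis le_add_same_cancel1 zero_le_dist)
  have "dist x (toward x y (dist x w)) + dist (toward x y (dist x w)) y = dist x y"
    using dist_toward[of "dist x w" x y] by simp
  from geodesic_point_unique[OF c this] geodesic_point_unique[OF c assms] show ?thesis
    using dist_toward[of "dist x w" x y] * by simp
qed

lemma toward_0 [simp]: "toward (x::'a) y 0 = x"
  using dist_toward(1)[of 0 x y] by simp

lemma toward_far: "dist x y \<le> t \<Longrightarrow> toward (x::'a) y t = y"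
  using dist_toward(2)[of t x y] by (smt (verit) zero_le_dist dist_eq_0_iff)

lemma toward_toward:
  fixes x y :: 'a
  assumes "0 \<le> s" "s \<le> t"
  shows "toward x (toward x y t) s = toward x y s"
proof -
  let ?p = "toward x y t" let ?q = "toward x ?p s"
  have d: "dist x ?p = min t (dist x y)" "dist ?p y = dist x y - min t (dist x y)"
    "dist x ?q = min s (dist x ?p)" "dist ?q ?p = dist x ?p - min s (dist x ?p)"
    using assms by (auto simp: dist_toward)
  have q: "dist x ?q = min s (dist x y)"
    using d(1,3) assms by auto
  have "dist ?q y \<le> dist ?q ?p + dist ?p y" "dist x y \<le> dist x ?q + dist ?q y"
    by (rule dist_triangle)+
  then have "dist x ?q + dist ?q y = dist x y"
    using d by linarith
  then have "toward x y (min s (dist x y)) = ?q"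
    using toward_unique[of x ?q y] q by simp
  then show ?thesis
    by (cases "s \<le> dist x y") (auto simp: min_def toward_far)
qed

lemma geodesically_convexD:
  fixes x y w :: 'a
  assumes "geodesically_convex C" "x \<in> C" "y \<in> C" "dist x w + dist w y = dist x y"
  shows "w \<in> C"
proof -
  obtain c where c: "geodesic_from_to c x y"
    using geodesic_exists by blast
  have "dist x w \<le> dist x y"
    using assms by (metis le_add_same_cancel1 zero_le_dist)
  then have "w \<in> c ` {0..dist x y}"
    using geodesic_point_unique[OF c assms(4)] by auto
  then show ?thesis
    using assms c unfolding geodesically_convex_def geodesic_segments_def by blast
qed

lemma toward_in_convex:
  fixes x y :: 'a
  assumes "geodesically_convex C" "x \<in> C" "y \<in> C" "0 \<le> t"
  shows "toward x y t \<in> C"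
  using assms dist_toward[of t x y] by (intro geodesically_convexD[OF assms(1-3)]) auto

section \<open>Contraction of geodesics from a common origin\<close>

lemma dist_proportional:
  fixes x y z p q :: 'a
  assumes l: "0 \<le> l" "l \<le> 1"
    and p: "dist x p = l * dist x y" "dist p y = (1 - l) * dist x y"
    and q: "dist x q = l * dist x z" "dist q z = (1 - l) * dist x z"
  shows "dist p q \<le> l * dist y z"
proof -
  \<comment> \<open>Stewart is applied twice: first to \<open>y\<close> and the side from
    \<open>x\<close> to \<open>z\<close>, then to \<open>q\<close> and the side from
    \<open>x\<close> to \<open>y\<close>. After inserting the first bound in the second, everything
    but \<open>(l * dist y z)^2\<close> cancels.\<close>
  have "(dist y q)\<^sup>2 \<le> (1 - l) * (dist y x)\<^sup>2 + l * (dist y z)\<^sup>2 - l * (1 - l) * (dist x z)\<^sup>2"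
    by (rule stewart[OF l q])
  then have "l * (dist y q)\<^sup>2 \<le>
      l * ((1 - l) * (dist y x)\<^sup>2 + l * (dist y z)\<^sup>2 - l * (1 - l) * (dist x z)\<^sup>2)"
    by (rule mult_left_mono) (rule l)
  moreover have "(dist q p)\<^sup>2 \<le> (1 - l) * (dist q x)\<^sup>2 + l * (dist q y)\<^sup>2 - l * (1 - l) * (dist x y)\<^sup>2"
    by (rule stewart[OF l p])
  ultimately have "(dist p q)\<^sup>2 \<le> (1 - l) * (l * dist x z)\<^sup>2
      + l * ((1 - l) * (dist x y)\<^sup>2 + l * (dist y z)\<^sup>2 - l * (1 - l) * (dist x z)\<^sup>2)
      - l * (1 - l) * (dist x y)\<^sup>2"
    using q by (simp add: dist_commute)
  also have "\<dots> = (l * dist y z)\<^sup>2"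
    by (simp add: power2_eq_square algebra_simps)
  finally show ?thesis
    using l by (simp add: power2_le_iff_abs_le abs_mult)
qed

lemma dist_toward_same_radius:
  fixes x y z :: 'a
  assumes "0 \<le> r" "r \<le> \<rho>" "0 < \<rho>" "dist x y = \<rho>" "dist x z = \<rho>"
  shows "dist (toward x y r) (toward x z r) \<le> r / \<rho> * dist y z"
proof -
  have "dist (toward x y r) y = \<rho> - r" "dist (toward x z r) z = \<rho> - r"
    "dist x (toward x y r) = r" "dist x (toward x z r) = r"
    using assms by (auto simp: dist_toward)
  then show ?thesis
    using assms by (intro dist_proportional[of "r / \<rho>" x _ y _ z]) (auto simp: left_diff_distrib)
qed

text \<open>The factor 2 is the price of unequal lengths: cutting the longer geodesic to the length
  of the shorter one moves its end by at most \<open>dist y z\<close>.\<close>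

lemma dist_toward_scaled:
  fixes x y z :: 'a
  assumes r: "0 \<le> r" "r \<le> \<rho>" "0 < \<rho>" and yz: "\<rho> \<le> dist x y" "\<rho> \<le> dist x z"
  shows "dist (toward x y r) (toward x z r) \<le> 2 * r / \<rho> * dist y z"
proof -
  have *: "dist (toward x y r) (toward x z r) \<le> 2 * r / \<rho> * dist y z"
    if le: "\<rho> \<le> dist x y" "dist x y \<le> dist x z" for y z
  proof -
    define z' where "z' = toward x z (dist x y)"
    have z': "dist x z' = dist x y" "dist z' z = dist x z - dist x y"
      using dist_toward[of "dist x y" x z] le by (auto simp: z'_def)
    have "dist x z \<le> dist x y + dist y z"
      by (rule dist_triangle)
    then have "dist y z' \<le> 2 * dist y z"
      using dist_triangle[of y z' z] z' by (simp add: dist_commute)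
    moreover have "r / dist x y \<le> r / \<rho>"
      using r le by (intro divide_left_mono mult_pos_pos) auto
    ultimately have "r / dist x y * dist y z' \<le> r / \<rho> * (2 * dist y z)"
      using r le by (intro mult_mono) auto
    moreover have "dist (toward x y r) (toward x z' r) \<le> r / dist x y * dist y z'"
      using r le z' by (intro dist_toward_same_radius) auto
    moreover have "toward x z' r = toward x z r"
      unfolding z'_def using r le by (intro toward_toward) auto
    ultimately show ?thesis
      by (simp add: mult_ac)
  qed
  show ?thesis
    using *[of y z] *[of z y] yz by (cases "dist x y \<le> dist x z") (auto simp: dist_commute)
qed

text \<open>One bound for every radius, including those beyond the ends: geodesics to close points
  are uniformly close, which the stability of entry into a block requires.\<close>

lemma dist_toward_le:
  fixes x y z :: 'a
  assumes r: "0 \<le> r"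
  shows "dist (toward x y r) (toward x z r) \<le> 2 * dist y z"
proof -
  have *: "dist (toward x y r) (toward x z r) \<le> 2 * dist y z" if le: "dist x y \<le> dist x z" for y z
  proof (cases "r < dist x y")
    case True
    then show ?thesis
    proof -
      have "2 * r / dist x y * dist y z \<le> 2 * dist y z"
        using True r by (intro mult_right_mono) (auto simp: divide_simps)
      then show ?thesis
        using dist_toward_scaled[of r "dist x y" x y z] le r True by linarith
    qed
  next
    case False
    then have 1: "toward x y r = y"
      by (simp add: toward_far)
    have "dist (toward x z r) z \<le> dist y z"
      using dist_toward[of r x z] r False dist_triangle[of x z y] by (auto simp: min_def)
    then show ?thesis
      unfolding 1 using dist_triangle[of y "toward x z r" z] by (simp add: dist_commute)
  qed
  show ?thesis
    using *[of y z] *[of z y] by (cases "dist x y \<le> dist x z") (auto simp: dist_commute)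
qed

lemma dist_toward_toward:
  fixes x y :: 'a
  assumes "0 \<le> s" "0 \<le> t"
  shows "dist (toward x y s) (toward x y t) = \<bar>min s (dist x y) - min t (dist x y)\<bar>"
  using assms
proof (induction s t rule: linorder_wlog)
  case (sym s t)
  then show ?case
    by (metis abs_minus_commute dist_commute)
next
  case (le s t)
  then have *: "toward x y s = toward x (toward x y t) s"
    by (simp add: toward_toward)
  show ?case
    unfolding * using le dist_toward(2)[of s x "toward x y t"] dist_toward(1)[of t x y]
    by auto
qed

lemma continuous_on_toward: "continuous_on {0..} (toward (x::'a) y)"
proof (rule continuous_onI)
  fix t e :: real
  assume "t \<in> {0..}" "0 < e"
  then show "\<exists>d>0. \<forall>t'\<in>{0..}. dist t' t < d \<longrightarrow> dist (toward x y t') (toward x y t) \<le> e"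
    by (intro exI[of _ e]) (auto simp: dist_toward_toward dist_real_def)
qed


end

subsection \<open>Rays and the cone topology\<close>

text \<open>Tychonoff's theorem in place of diagonal subsequences. The index set may be uncountable,
  so that all radii and all curve parameters converge together; the subsequence becomes a filter
  finer than \<open>sequentially\<close>.\<close>

lemma compact_coordinatewise_limit:
  fixes F :: "nat \<Rightarrow> 'i \<Rightarrow> 'b::topological_space"
  assumes K: "\<And>i. compact (K i)" and F: "\<And>n i. F n i \<in> K i"
  obtains U G where "U \<noteq> bot" "U \<le> sequentially" "\<And>i. ((\<lambda>n. F n i) \<longlongrightarrow> G i) U"
proof -
  have "compactin (product_topology (\<lambda>_. euclidean) UNIV) (PiE UNIV K)"
    using K by (simp add: compactin_PiE)
  then have "compact (PiE UNIV K)"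
    by (simp add: euclidean_product_topology)
  moreover have "filtermap F sequentially \<noteq> bot"
    by (simp add: filtermap_bot_iff)
  moreover have "eventually (\<lambda>f. f \<in> PiE UNIV K) (filtermap F sequentially)"
    using F by (simp add: eventually_filtermap PiE_iff)
  ultimately obtain G where G: "inf (nhds G) (filtermap F sequentially) \<noteq> bot"
    unfolding compact_filter by metis
  \<comment> \<open>The neighbourhoods of the cluster point \<open>G\<close> pulled back to the
    indices; this filter is proper just because \<open>G\<close> is a cluster point.\<close>
  define U where "U = inf sequentially (filtercomap F (nhds G))"
  have "U \<noteq> bot"
  proof
    assume "U = bot"
    then have "eventually (\<lambda>_. False) U"
      by simp
    then obtain P Q where PQ: "eventually P sequentially" "eventually Q (nhds G)"
      "\<And>n. P n \<Longrightarrow> Q (F n) \<Longrightarrow> False"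
      unfolding U_def eventually_inf eventually_filtercomap by metis
    have "eventually (\<lambda>f. \<not> Q f) (filtermap F sequentially)"
      unfolding eventually_filtermap using PQ(1) by eventually_elim (use PQ(3) in blast)
    then have "eventually (\<lambda>_. False) (inf (nhds G) (filtermap F sequentially))"
      unfolding eventually_inf using PQ(2) by blast
    with G show False
      by (simp add: eventually_False)
  qed
  moreover have "U \<le> sequentially"
    by (simp add: U_def)
  moreover have "((\<lambda>n. F n i) \<longlongrightarrow> G i) U" for i
  proof -
    have F: "filterlim F (nhds G) U"
      unfolding U_def by (metis filterlim_filtercomap filterlim_mono inf_le2 order_refl)
    show ?thesis
    proof (rule topological_tendstoI)
      fix S assume S: "open S" "G i \<in> S"
      have "open ((\<lambda>f. f i) -` S)"
        using S(1) by (intro open_vimage continuous_on_product_coordinates)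
      then have "eventually (\<lambda>n. F n \<in> (\<lambda>f. f i) -` S) U"
        using F S(2) by (intro topological_tendstoD[OF F]) auto
      then show "eventually (\<lambda>n. F n i \<in> S) U"
        by simp
    qed
  qed
  ultimately show ?thesis
    using that by blast
qed

lemma geodesic_ray_dist: "geodesic_ray c \<Longrightarrow> 0 \<le> s \<Longrightarrow> 0 \<le> t \<Longrightarrow> dist (c s) (c t) = \<bar>s - t\<bar>"
  by (auto simp: geodesic_ray_def)

definition endpoint :: "(real \<Rightarrow> 'a::metric_space) \<Rightarrow> (real \<Rightarrow> 'a) set" where
  "endpoint c = asymptotic_rel `` {c}"

lemma endpoint_in_boundary: "geodesic_ray c \<Longrightarrow> endpoint c \<in> visual_boundary"
  by (auto simp: endpoint_def visual_boundary_def intro: quotientI)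

lemma mem_endpoint: "geodesic_ray c \<Longrightarrow> c \<in> endpoint c"
  by (auto simp: endpoint_def asymptotic_rel_def)

lemma boundary_eq_endpoint: "\<alpha> \<in> visual_boundary \<Longrightarrow> c \<in> \<alpha> \<Longrightarrow> geodesic_ray c \<and> \<alpha> = endpoint c"
proof -
  assume "\<alpha> \<in> visual_boundary" "c \<in> \<alpha>"
  then obtain c' where c': "\<alpha> = asymptotic_rel `` {c'}" "(c', c) \<in> asymptotic_rel"
    by (auto simp: visual_boundary_def elim: quotientE)
  then show ?thesis
    using equiv_class_eq[OF equiv_asymptotic_rel c'(2)] by (auto simp: endpoint_def asymptotic_rel_def)
qed

lemma mem_endpointI:
  "geodesic_ray c \<Longrightarrow> geodesic_ray c' \<Longrightarrow> (\<And>t. 0 \<le> t \<Longrightarrow> dist (c t) (c' t) \<le> K) \<Longrightarrow> c' \<in> endpoint c"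
  by (auto simp: endpoint_def asymptotic_rel_def)

lemma asymptotic_bound:
  assumes "\<alpha> \<in> visual_boundary" "c \<in> \<alpha>" "c' \<in> \<alpha>"
  obtains K where "\<And>t. 0 \<le> t \<Longrightarrow> dist (c t) (c' t) \<le> K"
  using boundary_eq_endpoint[OF assms(1,2)] assms(3) unfolding endpoint_def asymptotic_rel_def by auto

context proper_CAT0
begin

lemma toward_ray:
  fixes c :: "real \<Rightarrow> 'a"
  assumes c: "geodesic_ray c" and "0 \<le> s" "0 \<le> t"
  shows "toward (c 0) (c t) s = c (min s t)"
proof (cases "s \<le> t")
  case True
  then have "dist (c 0) (c s) = s" "dist (c 0) (c s) + dist (c s) (c t) = dist (c 0) (c t)"
    using assms by (auto simp: geodesic_ray_dist[OF c])
  then show ?thesis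
    using toward_unique[of "c 0" "c s" "c t"] True by (simp add: min_def)
next
  case False
  then show ?thesis
    using assms by (simp add: toward_far geodesic_ray_dist[OF c])
qed

text \<open>The points \<open>c s\<close> and \<open>c' s\<close> stay within \<open>K\<close> of
  each other, at distance at least \<open>s - K\<close> from \<open>c 0\<close>. Contraction to
  radius \<open>r\<close> leaves \<open>2 * r * K / (s - K)\<close>, which tends to 0.\<close>

lemma tendsto_toward_asymptotic:
  fixes c c' :: "real \<Rightarrow> 'a"
  assumes c: "geodesic_ray c" and c': "geodesic_ray c'"
    and K: "\<And>t. 0 \<le> t \<Longrightarrow> dist (c t) (c' t) \<le> K" and r: "0 \<le> r"
  shows "((\<lambda>s. toward (c 0) (c' s) r) \<longlongrightarrow> c r) at_top"
proof -
  have "((\<lambda>s. dist (toward (c 0) (c' s) r) (c r)) \<longlongrightarrow> 0) at_top"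
  proof (rule tendsto_sandwich[of "\<lambda>_. 0"])
    show "\<forall>\<^sub>F s in at_top. dist (toward (c 0) (c' s) r) (c r) \<le> 2 * r / (s - K) * K"
      using eventually_ge_at_top[of "r + 1"] eventually_ge_at_top[of "r + K + 1"]
    proof eventually_elim
      case (elim s)
      have K0: "0 \<le> K"
        using K[of 0] zero_le_dist[of "c 0" "c' 0"] by linarith
      have s: "0 \<le> s" "0 < s - K" "r \<le> s - K"
        using elim r K0 by linarith+
      have "dist (c 0) (c s) = s"
        using c s by (simp add: geodesic_ray_dist)
      moreover have "s - K \<le> dist (c 0) (c' s)"
        using dist_triangle[of "c 0" "c s" "c' s"] K[of s] s calculation by (simp add: dist_commute)
      ultimately have "dist (toward (c 0) (c' s) r) (toward (c 0) (c s) r)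
          \<le> 2 * r / (s - K) * dist (c' s) (c s)"
        using r s K0 by (intro dist_toward_scaled) auto
      also have "\<dots> \<le> 2 * r / (s - K) * K"
        using r s K[of s] by (intro mult_left_mono) (auto simp: dist_commute)
      finally show ?case
        using toward_ray[OF c r s(1)] elim by (simp add: min_def)
    qed
    show "((\<lambda>s. 2 * r / (s - K) * K) \<longlongrightarrow> 0) at_top"
    proof -
      have "filterlim (\<lambda>s. - K + s) at_top at_top"
        by (intro filterlim_tendsto_add_at_top[OF tendsto_const] filterlim_ident)
      then have "((\<lambda>s. 2 * r * K / (- K + s)) \<longlongrightarrow> 0) at_top"
        by (intro tendsto_divide_0[OF tendsto_const] filterlim_at_top_imp_at_infinity)
      then show ?thesis
        by simp
    qed
  qed auto
  then show ?thesis
    by (subst tendsto_dist_iff)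
qed

text \<open>Both rays are the limit of the same geodesics, those from the common origin to the
  points \<open>c' s\<close>.\<close>

lemma asymptotic_rays_eq:
  fixes c c' :: "real \<Rightarrow> 'a"
  assumes c: "geodesic_ray c" and c': "geodesic_ray c'" and 0: "c 0 = c' 0"
    and K: "\<And>t. 0 \<le> t \<Longrightarrow> dist (c t) (c' t) \<le> K" and r: "0 \<le> r"
  shows "c r = c' r"
proof (rule tendsto_unique)
  show "((\<lambda>s. toward (c 0) (c' s) r) \<longlongrightarrow> c r) at_top"
    by (rule tendsto_toward_asymptotic[OF c c' K r])
  show "((\<lambda>s. toward (c 0) (c' s) r) \<longlongrightarrow> c' r) at_top"
    unfolding 0 by (rule tendsto_toward_asymptotic[OF c' c' _ r]) auto
qed auto

section \<open>Rays as limits of geodesics\<close>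

lemma limit_is_ray:
  fixes x :: 'a
  assumes U: "U \<noteq> bot" and far: "\<And>r. eventually (\<lambda>i. r \<le> dist x (p i)) U"
    and g: "\<And>r. 0 \<le> r \<Longrightarrow> ((\<lambda>i. toward x (p i) r) \<longlongrightarrow> g r) U"
  shows "geodesic_ray g" "g 0 = x"
proof -
  show "geodesic_ray g"
    unfolding geodesic_ray_def
  proof (intro allI impI)
    fix s t :: real assume st: "0 \<le> s" "0 \<le> t"
    have "((\<lambda>i. dist (toward x (p i) s) (toward x (p i) t)) \<longlongrightarrow> dist (g s) (g t)) U"
      using g st by (intro tendsto_dist)
    moreover have "eventually (\<lambda>i. dist (toward x (p i) s) (toward x (p i) t) = \<bar>s - t\<bar>) U"
      using far[of "max s t"] by eventually_elim (use st in \<open>auto simp: dist_toward_toward\<close>)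
    ultimately have "((\<lambda>i. \<bar>s - t\<bar>) \<longlongrightarrow> dist (g s) (g t)) U"
      by (rule Lim_transform_eventually)
    then show "dist (g s) (g t) = \<bar>s - t\<bar>"
      using U by (simp add: tendsto_const_iff)
  qed
  show "g 0 = x"
    using g[of 0] U by (simp add: tendsto_const_iff)
qed

text \<open>The ray is a limit of the geodesics from \<open>x\<close> to \<open>c n\<close>;
  properness supplies the limit, and \<open>near\<close> keeps it within bounded distance of
  \<open>c\<close>.\<close>

lemma asymptotic_ray_exists:
  fixes c :: "real \<Rightarrow> 'a"
  assumes c: "geodesic_ray c"
  shows "\<exists>g. geodesic_ray g \<and> g 0 = x \<and> g \<in> endpoint c"
proof -
  define K where "K = dist x (c 0)"
  \<comment> \<open>One \<open>K\<close> comes from comparing proportional points in the triangle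
    with apex \<open>c n\<close>, the other from the change of parameter, as the lengths
    \<open>L\<close> and \<open>n\<close> differ by at most \<open>K\<close>.\<close>
  have near: "dist (toward x (c n) r) (c r) \<le> 2 * K" if r: "0 \<le> r" "r \<le> n" "0 < n" for r n
  proof -
    define L where "L = dist x (c n)"
    define l where "l = r / n"
    define p where "p = toward x (c n) (l * L)"
    have l: "0 \<le> l" "l \<le> 1" "r = l * n"
      using r by (auto simp: l_def)
    have d: "dist (c n) (c 0) = n" "dist (c r) (c 0) = l * n" "dist (c n) (c r) = (1 - l) * n"
      using r l by (simp_all add: geodesic_ray_dist[OF c] left_diff_distrib)
    have L: "\<bar>L - n\<bar> \<le> K"
      using dist_triangle[of x "c n" "c 0"] dist_triangle[of "c 0" "c n" x] d(1)
      by (simp add: L_def K_def dist_commute)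
    have L0: "0 \<le> L" "0 \<le> l * L" "l * L \<le> L"
      using l by (auto simp: L_def mult_left_le_one_le)
    then have "dist x p = l * L" "dist p (c n) = L - l * L"
      unfolding p_def by (auto simp: dist_toward L_def)
    then have "dist p (c r) \<le> (1 - l) * dist x (c 0)"
      using l d by (intro dist_proportional[of _ "c n"]) (simp_all add: L_def dist_commute left_diff_distrib)
    also have "\<dots> \<le> 1 * K"
      unfolding K_def using l by (intro mult_right_mono) auto
    finally have 1: "dist p (c r) \<le> K"
      by simp
    have "dist (toward x (c n) r) p = \<bar>min r L - min (l * L) L\<bar>"
      unfolding p_def L_def using r(1) L0(2) by (intro dist_toward_toward) (auto simp: L_def)
    also have "\<dots> \<le> \<bar>r - l * L\<bar>"
      by (auto simp: min_def abs_if)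
    also have "r - l * L = l * (n - L)"
      using l(3) by (simp add: right_diff_distrib)
    also have "\<bar>\<dots>\<bar> = l * \<bar>L - n\<bar>"
      using l(1) by (simp add: abs_mult abs_minus_commute)
    also have "\<dots> \<le> 1 * K"
      using l L by (intro mult_mono) auto
    finally show ?thesis
      using 1 dist_triangle[of "toward x (c n) r" "c r" p] by simp
  qed
  \<comment> \<open>Truncation at 0 gives every real index a compact ball, although only radii
    \<open>r \<ge> 0\<close> matter.\<close>
  define F where "F n r = toward x (c (real n)) (max 0 r)" for n r
  obtain U G where U: "U \<noteq> bot" "U \<le> sequentially" and G: "\<And>r. ((\<lambda>n. F n r) \<longlongrightarrow> G r) U"
  proof (rule compact_coordinatewise_limit[of "\<lambda>r. cball x (max 0 r)" F])
    show "compact (cball x (max 0 r))" for r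
      by (rule compact_cball)
    show "F n r \<in> cball x (max 0 r)" for n r
      by (simp add: F_def dist_toward)
  qed (rule that)
  have G': "((\<lambda>n. toward x (c (real n)) r) \<longlongrightarrow> G r) U" if "0 \<le> r" for r
    using G[of r] that by (simp add: F_def)
  have large: "eventually (\<lambda>n. r \<le> real n) U" for r
    using filter_leD[OF U(2)] eventually_ge_at_top[of "nat \<lceil>r\<rceil>"] by (simp add: nat_ceiling_le_eq)
  have far: "eventually (\<lambda>n. r \<le> dist x (c (real n))) U" for r
    using large[of "r + K"]
  proof eventually_elim
    case (elim n)
    have "dist (c 0) (c (real n)) = n"
      by (simp add: geodesic_ray_dist[OF c])
    then show ?case
      using dist_triangle[of "c 0" "c (real n)" x] elim by (simp add: K_def dist_commute)
  qed
  have ray: "geodesic_ray G" "G 0 = x"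
    using limit_is_ray[OF U(1) far G'] by blast+
  have "dist (G r) (c r) \<le> 2 * K" if r: "0 \<le> r" for r
  proof (rule tendsto_upperbound)
    show "((\<lambda>n. dist (toward x (c (real n)) r) (c r)) \<longlongrightarrow> dist (G r) (c r)) U"
      by (intro tendsto_intros G' r)
    show "eventually (\<lambda>n. dist (toward x (c (real n)) r) (c r) \<le> 2 * K) U"
      using large[of "r + 1"] by eventually_elim (use near r in auto)
  qed (rule U)
  then have "G \<in> endpoint c"
    using ray c by (intro mem_endpointI[of _ _ "2 * K"]) (auto simp: dist_commute)
  with ray show ?thesis
    by blast
qed

lemma ray_from:
  assumes "\<alpha> \<in> visual_boundary"
  shows "ray_from x \<alpha> \<in> \<alpha>" "ray_from (x::'a) \<alpha> 0 = x" "geodesic_ray (ray_from x \<alpha>)"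
proof -
  obtain c where c: "geodesic_ray c" "\<alpha> = endpoint c"
    using assms by (auto simp: visual_boundary_def endpoint_def elim: quotientE)
  then have "\<exists>g. g \<in> \<alpha> \<and> g 0 = x"
    using asymptotic_ray_exists by blast
  from someI_ex[OF this] show *: "ray_from x \<alpha> \<in> \<alpha>" "ray_from x \<alpha> 0 = x"
    by (auto simp: ray_from_def)
  then show "geodesic_ray (ray_from x \<alpha>)"
    using boundary_eq_endpoint assms by blast
qed

lemma ray_from_unique:
  fixes c :: "real \<Rightarrow> 'a"
  assumes "\<alpha> \<in> visual_boundary" "c \<in> \<alpha>" "0 \<le> t"
  shows "ray_from (c 0) \<alpha> t = c t"
proof -
  note r = ray_from[OF assms(1), of "c 0"]
  obtain K where K: "\<And>t. 0 \<le> t \<Longrightarrow> dist (ray_from (c 0) \<alpha> t) (c t) \<le> K"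
    using asymptotic_bound[OF assms(1) r(1) assms(2)] by blast
  have "geodesic_ray c"
    using boundary_eq_endpoint[OF assms(1,2)] by blast
  from asymptotic_rays_eq[OF r(3) this r(2) K assms(3)] show ?thesis .
qed

lemma ray_from_endpoint:
  fixes c :: "real \<Rightarrow> 'a"
  assumes "geodesic_ray c" "0 \<le> t"
  shows "ray_from (c 0) (endpoint c) t = c t"
  using ray_from_unique[OF endpoint_in_boundary[OF assms(1)] mem_endpoint[OF assms(1)] assms(2)] .

lemma boundary_eqI:
  assumes \<alpha>: "\<alpha> \<in> visual_boundary" and \<beta>: "\<beta> \<in> visual_boundary"
    and eq: "\<And>t. 0 \<le> t \<Longrightarrow> ray_from (x::'a) \<alpha> t = ray_from x \<beta> t"
  shows "\<alpha> = \<beta>"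
proof -
  have \<alpha>': "\<alpha> = endpoint (ray_from x \<alpha>)" and \<beta>': "\<beta> = endpoint (ray_from x \<beta>)"
    using boundary_eq_endpoint[OF \<alpha> ray_from(1)[OF \<alpha>, of x]] boundary_eq_endpoint[OF \<beta> ray_from(1)[OF \<beta>, of x]]
    by auto
  have "dist (ray_from x \<alpha> t) (ray_from x \<beta> t) \<le> 0" if "0 \<le> t" for t
    using eq[OF that] by simp
  then have "ray_from x \<beta> \<in> endpoint (ray_from x \<alpha>)"
    by (rule mem_endpointI[OF ray_from(3)[OF \<alpha>] ray_from(3)[OF \<beta>]])
  then have "ray_from x \<beta> \<in> \<alpha>"
    using \<alpha>' by simp
  from boundary_eq_endpoint[OF \<alpha> this] \<beta>' show ?thesis
    by simp
qed

lemma toward_tendsto_ray_from: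
  fixes c :: "real \<Rightarrow> 'a"
  assumes "\<alpha> \<in> visual_boundary" "c \<in> \<alpha>" "0 \<le> r"
  shows "((\<lambda>s. toward x (c s) r) \<longlongrightarrow> ray_from x \<alpha> r) at_top"
proof -
  obtain K where K: "\<And>t. 0 \<le> t \<Longrightarrow> dist (ray_from x \<alpha> t) (c t) \<le> K"
    using asymptotic_bound[OF assms(1) ray_from(1)[OF assms(1), of x] assms(2)] by blast
  have "geodesic_ray c"
    using boundary_eq_endpoint[OF assms(1,2)] by blast
  from tendsto_toward_asymptotic[OF ray_from(3)[OF assms(1)] this K assms(3)] show ?thesis
    by (simp only: ray_from(2)[OF assms(1)])
qed

section \<open>The cone topology through evaluation of rays\<close>

lemma mem_cone_nhd:
  fixes c :: "real \<Rightarrow> 'a"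
  assumes "0 \<le> r"
  shows "\<alpha> \<in> cone_nhd c r \<epsilon> \<longleftrightarrow> \<alpha> \<in> visual_boundary \<and> dist (ray_from (c 0) \<alpha> r) (c r) < \<epsilon>"
proof (cases "\<alpha> \<in> visual_boundary")
  case True
  then show ?thesis
    unfolding cone_nhd_def using ray_from(1,2)[OF True, of "c 0"] ray_from_unique[OF True _ assms]
    by (simp, metis)
qed (auto simp: cone_nhd_def)

lemma topspace_cone_topology: "topspace (cone_topology (x0::'a)) = visual_boundary"
proof -
  have *: "\<alpha> \<in> cone_nhd (ray_from x0 \<alpha>) 1 1" if "\<alpha> \<in> visual_boundary" for \<alpha>
    using ray_from[OF that, of x0] that by (subst mem_cone_nhd) auto
  then have "\<exists>c r \<epsilon>. geodesic_ray c \<and> c 0 = x0 \<and> 0 < r \<and> 0 < \<epsilon> \<and> \<alpha> \<in> cone_nhd c r \<epsilon>"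
    if "\<alpha> \<in> visual_boundary" for \<alpha>
    by (intro exI[of _ "ray_from x0 \<alpha>"] exI[of _ 1] conjI * that ray_from zero_less_one)
  moreover have "cone_nhd c r \<epsilon> \<subseteq> visual_boundary" for c :: "real \<Rightarrow> 'a" and r \<epsilon>
    by (auto simp: cone_nhd_def)
  ultimately show ?thesis
    unfolding cone_topology_def topology_generated_by_topspace by blast
qed

text \<open>A set \<open>cone_nhd c r \<epsilon>\<close> with \<open>c 0 = x0\<close> is the
  preimage of the ball about \<open>c r\<close> under evaluation at time \<open>r\<close> of the ray
  from \<open>x0\<close>. Continuity of a path in the boundary thus becomes metric continuity in the
  space, one radius at a time.\<close>

lemma pathin_cone_topology:
  "pathin (cone_topology (x0::'a)) g \<longleftrightarrow>
    g \<in> {0..1} \<rightarrow> visual_boundary \<and> (\<forall>r>0. continuous_on {0..1} (\<lambda>t. ray_from x0 (g t) r))"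
    (is "?L \<longleftrightarrow> ?R")
proof
  assume L: ?L
  then have g: "g \<in> {0..1} \<rightarrow> visual_boundary"
    using path_image_subset_topspace topspace_cone_topology by metis
  have "continuous_on {0..1} (\<lambda>t. ray_from x0 (g t) r)" if r: "0 < r" for r
  proof (rule continuous_onI)
    fix t e :: real assume t: "t \<in> {0..1}" and e: "0 < e"
    define V where "V = cone_nhd (ray_from x0 (g t)) r e"
    have gt: "g t \<in> visual_boundary"
      using g t by auto
    then have "openin (cone_topology x0) V"
      unfolding cone_topology_def V_def using r e ray_from[OF gt, of x0]
      by (intro topology_generated_by_Basis) blast
    with L have "openin (top_of_set {0..1}) {u \<in> topspace (top_of_set {0..1}). g u \<in> V}"
      unfolding pathin_def by (rule openin_continuous_map_preimage)
    moreover have "t \<in> {u \<in> topspace (top_of_set {0..1}). g u \<in> V}"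
      using t e r gt ray_from[OF gt, of x0] by (simp add: V_def mem_cone_nhd)
    ultimately obtain d where "0 < d" and d: "ball t d \<inter> {0..1} \<subseteq> {u \<in> topspace (top_of_set {0..1}). g u \<in> V}"
      unfolding openin_contains_ball by blast
    moreover have "dist (ray_from x0 (g u) r) (ray_from x0 (g t) r) \<le> e" if "u \<in> {0..1}" "dist u t < d" for u
    proof -
      have "g u \<in> V"
        using d that by (auto simp: dist_commute)
      then show ?thesis
        using r ray_from[OF gt, of x0] by (simp add: V_def mem_cone_nhd)
    qed
    ultimately show "\<exists>d>0. \<forall>u\<in>{0..1}. dist u t < d \<longrightarrow> dist (ray_from x0 (g u) r) (ray_from x0 (g t) r) \<le> e"
      by blast
  qed
  with g show ?R
    by blast
next
  assume R: ?R
  show ?L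
    unfolding pathin_def cone_topology_def
  proof (rule continuous_on_generated_topo)
    show "g ` topspace (top_of_set {0..1}) \<subseteq>
        \<Union>{cone_nhd c r \<epsilon> |c r \<epsilon>. geodesic_ray c \<and> c 0 = x0 \<and> 0 < r \<and> 0 < \<epsilon>}"
      (is "_ \<subseteq> ?U")
    proof -
      have "?U = visual_boundary"
        using topspace_cone_topology[of x0] unfolding cone_topology_def topology_generated_by_topspace .
      then show ?thesis
        using R by (simp add: image_subset_iff_funcset)
    qed
    fix V assume "V \<in> {cone_nhd c r \<epsilon> |c r \<epsilon>. geodesic_ray c \<and> c 0 = x0 \<and> 0 < r \<and> 0 < \<epsilon>}"
    then obtain c r \<epsilon> where V: "V = cone_nhd c r \<epsilon>" "geodesic_ray c" "c 0 = x0" "0 < r" "0 < \<epsilon>"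
      by blast
    have "openin (top_of_set {0..1}) ({0..1} \<inter> (\<lambda>t. ray_from x0 (g t) r) -` ball (c r) \<epsilon>)"
      using R V by (intro continuous_openin_preimage_gen) auto
    also have "{0..1} \<inter> (\<lambda>t. ray_from x0 (g t) r) -` ball (c r) \<epsilon> = g -` V \<inter> topspace (top_of_set {0..1})"
      using R V by (auto simp: mem_cone_nhd dist_commute)
    finally show "openin (top_of_set {0..1}) (g -` V \<inter> topspace (top_of_set {0..1}))" .
  qed
qed

end

subsection \<open>The tree of blocks\<close>

locale block_decomposed = proper_CAT0 X for X :: "'a::metric_space itself" +
  fixes \<B> :: "'a set set" and x0 :: 'a
  assumes block_decomposition: "block_decomposition \<B>"
    and basepoint: "x0 \<notin> \<Union>(walls \<B>)"
begin

lemma closed_block: "B \<in> \<B> \<Longrightarrow> closed B"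
  and convex_block: "B \<in> \<B> \<Longrightarrow> geodesically_convex B"
  using block_decomposition by (simp_all add: block_decomposition_def)

lemma cover: "\<exists>B\<in>\<B>. y \<in> B"
proof -
  have "y \<in> \<Union>\<B>"
    using block_decomposition by (simp add: block_decomposition_def)
  then show ?thesis
    by simp
qed

lemma block_nonempty:
  assumes "B \<in> \<B>"
  shows "B \<noteq> {}"
proof -
  have "\<forall>B\<in>\<B>. \<exists>B1\<in>\<B> - {B}. \<exists>B2\<in>\<B> - {B}. B1 \<noteq> B2 \<and> B \<inter> B1 \<noteq> {} \<and> B \<inter> B2 \<noteq> {}"
    using block_decomposition unfolding block_decomposition_def by (elim conjE)
  with assms show ?thesis
    by fast
qed

section \<open>Local finiteness of the blocks\<close>

lemma no_three_blocks:
  assumes "B1 \<in> \<B>" "B2 \<in> \<B>" "B3 \<in> \<B>" "B1 \<inter> B2 \<noteq> {}" "B1 \<inter> B3 \<noteq> {}" "B2 \<inter> B3 \<noteq> {}"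
  shows "B1 = B2 \<or> B1 = B3 \<or> B2 = B3"
proof -
  have "\<exists>parity :: 'a set \<Rightarrow> bool. \<forall>B\<in>\<B>. \<forall>B'\<in>\<B>. B \<noteq> B' \<longrightarrow> B \<inter> B' \<noteq> {} \<longrightarrow> parity B \<noteq> parity B'"
    using block_decomposition unfolding block_decomposition_def by (elim conjE)
  then obtain parity :: "'a set \<Rightarrow> bool"
    where "\<forall>B\<in>\<B>. \<forall>B'\<in>\<B>. B \<noteq> B' \<longrightarrow> B \<inter> B' \<noteq> {} \<longrightarrow> parity B \<noteq> parity B'" ..
  then have "B \<noteq> B' \<Longrightarrow> B \<in> \<B> \<Longrightarrow> B' \<in> \<B> \<Longrightarrow> B \<inter> B' \<noteq> {} \<Longrightarrow> parity B \<noteq> parity B'" for B B'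
    by simp
  \<comment> \<open>Three distinct blocks that meet pairwise would need three different
    parities.\<close>
  from this[of B1 B2] this[of B1 B3] this[of B2 B3] show ?thesis
    using assms by argo
qed

lemma separation:
  "\<exists>\<epsilon>>0. \<forall>B\<in>\<B>. \<forall>B'\<in>\<B>. \<forall>u\<in>B. \<forall>u'\<in>B'. \<forall>y. dist u y < \<epsilon> \<longrightarrow> dist u' y < \<epsilon> \<longrightarrow> B \<inter> B' \<noteq> {}"
proof -
  have "\<exists>\<epsilon>>0. \<forall>B\<in>\<B>. \<forall>B'\<in>\<B>. B \<noteq> B' \<longrightarrow>
      (B \<inter> B' \<noteq> {} \<longleftrightarrow> (\<Union>x\<in>B. ball x \<epsilon>) \<inter> (\<Union>x\<in>B'. ball x \<epsilon>) \<noteq> {})"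
    using block_decomposition unfolding block_decomposition_def by (elim conjE)
  then obtain \<epsilon> where \<epsilon>: "0 < \<epsilon>" "\<forall>B\<in>\<B>. \<forall>B'\<in>\<B>. B \<noteq> B' \<longrightarrow>
      (B \<inter> B' \<noteq> {} \<longleftrightarrow> (\<Union>x\<in>B. ball x \<epsilon>) \<inter> (\<Union>x\<in>B'. ball x \<epsilon>) \<noteq> {})"
    by (elim exE conjE)
  show ?thesis
  proof (intro exI[of _ \<epsilon>] conjI ballI allI impI \<epsilon>(1))
    fix B B' u u' y
    assume *: "B \<in> \<B>" "B' \<in> \<B>" "u \<in> B" "u' \<in> B'" "dist u y < \<epsilon>" "dist u' y < \<epsilon>"
    then have "y \<in> (\<Union>x\<in>B. ball x \<epsilon>) \<inter> (\<Union>x\<in>B'. ball x \<epsilon>)"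
      by auto
    then have "(\<Union>x\<in>B. ball x \<epsilon>) \<inter> (\<Union>x\<in>B'. ball x \<epsilon>) \<noteq> {}"
      by (metis empty_iff)
    then show "B \<inter> B' \<noteq> {}"
      using * \<epsilon>(2)[rule_format, of B B'] by (cases "B = B'") auto
  qed
qed

text \<open>Any two blocks that meet the ball have intersecting neighbourhoods and hence intersect
  each other, so there are at most two of them.\<close>

lemma finite_blocks_near: "\<exists>\<epsilon>>0. \<forall>y. finite {B \<in> \<B>. B \<inter> ball y \<epsilon> \<noteq> {}}"
proof -
  obtain \<epsilon> where \<epsilon>: "0 < \<epsilon>"
    "\<forall>B\<in>\<B>. \<forall>B'\<in>\<B>. \<forall>u\<in>B. \<forall>u'\<in>B'. \<forall>y. dist u y < \<epsilon> \<longrightarrow> dist u' y < \<epsilon> \<longrightarrow> B \<inter> B' \<noteq> {}"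
    using separation by (elim exE conjE)
  have "finite {B \<in> \<B>. B \<inter> ball y \<epsilon> \<noteq> {}}" for y
  proof -
    let ?S = "{B \<in> \<B>. B \<inter> ball y \<epsilon> \<noteq> {}}"
    have adj: "B \<inter> B' \<noteq> {}" if "B \<in> ?S" "B' \<in> ?S" for B B'
    proof -
      obtain u u' where u: "u \<in> B" "u' \<in> B'" "dist u y < \<epsilon>" "dist u' y < \<epsilon>"
        using \<open>B \<in> ?S\<close> \<open>B' \<in> ?S\<close> by (auto simp: dist_commute)
      have "B \<in> \<B>" "B' \<in> \<B>"
        using that by simp_all
      from \<epsilon>(2)[rule_format, OF this u] show ?thesis .
    qed
    show ?thesis
    proof (cases "\<exists>B1 B2. B1 \<in> ?S \<and> B2 \<in> ?S \<and> B1 \<noteq> B2")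
      case True
      then obtain B1 B2 where B: "B1 \<in> ?S" "B2 \<in> ?S" "B1 \<noteq> B2"
        by blast
      have "?S \<subseteq> {B1, B2}"
      proof
        fix C assume C: "C \<in> ?S"
        have "B1 \<in> \<B>" "B2 \<in> \<B>" "C \<in> \<B>"
          using B C by simp_all
        from no_three_blocks[OF this adj[OF B(1,2)] adj[OF B(1) C] adj[OF B(2) C]]
        show "C \<in> {B1, B2}"
          using B(3) by auto
      qed
      then show ?thesis
        by (rule finite_subset) simp
    next
      case False
      then have "?S \<subseteq> {SOME B. B \<in> ?S}"
        by (metis (mono_tags, lifting) singletonI someI subsetI)
      then show ?thesis
        by (rule finite_subset) simp
    qed
  qed
  with \<epsilon>(1) show ?thesis
    by blast
qed

text \<open>By local finiteness, the union of the nearby closed blocks that miss \<open>y\<close> is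
  closed. In this form the lemma drives the arguments by local constancy: a small move away from
  \<open>y\<close> leads into no block that does not already contain \<open>y\<close>.\<close>

lemma near_blocks_contain_center: "\<exists>\<delta>>0. \<forall>B\<in>\<B>. \<forall>z\<in>B. dist y z < \<delta> \<longrightarrow> y \<in> B"
proof -
  obtain \<epsilon> where \<epsilon>: "0 < \<epsilon>" "finite {B \<in> \<B>. B \<inter> ball y \<epsilon> \<noteq> {}}"
    using finite_blocks_near by blast
  define C where "C = \<Union>{B \<in> \<B>. B \<inter> ball y \<epsilon> \<noteq> {} \<and> y \<notin> B}"
  have "closed C"
    unfolding C_def using \<epsilon>(2) closed_block by (intro closed_Union) (auto elim: rev_finite_subset)
  moreover have "y \<notin> C"
    by (auto simp: C_def)
  ultimately obtain d where d: "0 < d" "ball y d \<subseteq> - C"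
    by (metis ComplI open_Compl open_contains_ball)
  show ?thesis
  proof (intro exI conjI ballI impI)
    show "0 < min d \<epsilon>"
      using d \<epsilon> by simp
    fix B z assume *: "B \<in> \<B>" "z \<in> B" "dist y z < min d \<epsilon>"
    then have "z \<in> ball y d" "z \<in> B \<inter> ball y \<epsilon>"
      by auto
    then show "y \<in> B"
      using * d unfolding C_def by blast
  qed
qed

lemma finite_blocks_compact:
  assumes "compact K"
  shows "finite {B \<in> \<B>. B \<inter> K \<noteq> {}}"
proof -
  obtain \<epsilon> where \<epsilon>: "0 < \<epsilon>" "\<And>y. finite {B \<in> \<B>. B \<inter> ball y \<epsilon> \<noteq> {}}"
    using finite_blocks_near by blast
  obtain D where D: "finite D" "K \<subseteq> (\<Union>y\<in>D. ball y \<epsilon>)"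
    using assms \<epsilon>(1) unfolding compact_eq_totally_bounded by blast
  have "{B \<in> \<B>. B \<inter> K \<noteq> {}} \<subseteq> (\<Union>y\<in>D. {B \<in> \<B>. B \<inter> ball y \<epsilon> \<noteq> {}})"
    using D(2) by blast
  then show ?thesis
    by (rule finite_subset) (use D(1) \<epsilon>(2) in blast)
qed

lemma at_most_two_blocks:
  "\<lbrakk>B1 \<in> \<B>; B2 \<in> \<B>; B3 \<in> \<B>; y \<in> B1; y \<in> B2; y \<in> B3; B1 \<noteq> B3; B2 \<noteq> B3\<rbrakk> \<Longrightarrow> B1 = B2"
  using no_three_blocks[of B1 B2 B3] by blast

text \<open>These are the points outside all walls, together with their block. The condition is open
  in the point (\<open>sole_near\<close>), so it passes between a limit ray and the geodesics that
  approximate it.\<close>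

definition sole :: "'a \<Rightarrow> 'a set \<Rightarrow> bool" where
  "sole y B \<longleftrightarrow> B \<in> \<B> \<and> y \<in> B \<and> (\<forall>B'\<in>\<B>. y \<in> B' \<longrightarrow> B' = B)"

lemma sole_unique: "sole y B \<Longrightarrow> B' \<in> \<B> \<Longrightarrow> y \<in> B' \<Longrightarrow> B' = B"
  by (auto simp: sole_def)

lemma sole_near:
  assumes "sole y B"
  shows "\<exists>\<delta>>0. \<forall>z. dist y z < \<delta> \<longrightarrow> sole z B"
proof -
  obtain \<delta> where \<delta>: "0 < \<delta>" "\<And>B z. B \<in> \<B> \<Longrightarrow> z \<in> B \<Longrightarrow> dist y z < \<delta> \<Longrightarrow> y \<in> B"
    using near_blocks_contain_center by meson
  have "sole z B" if "dist y z < \<delta>" for z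
    using cover[of z] \<delta>(2)[OF _ _ that] assms unfolding sole_def by blast
  with \<delta>(1) show ?thesis
    by blast
qed

lemma root_exists: "\<exists>R. sole x0 R"
proof -
  obtain R where R: "R \<in> \<B>" "x0 \<in> R"
    using cover by blast
  have "B = R" if "B \<in> \<B>" "x0 \<in> B" for B
  proof (rule ccontr)
    assume "B \<noteq> R"
    then have "B \<inter> R \<in> walls \<B>"
      using R that unfolding walls_def by blast
    then show False
      using basepoint R that by blast
  qed
  with R show ?thesis
    by (auto simp: sole_def)
qed

definition root :: "'a set" where
  "root = (SOME R. sole x0 R)"

lemma sole_root: "sole x0 root"
  unfolding root_def using root_exists by (rule someI_ex)

lemma root_in: "root \<in> \<B>" and basepoint_in_root: "x0 \<in> root"
  using sole_root by (auto simp: sole_def)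

lemma basepoint_in_iff: "B \<in> \<B> \<Longrightarrow> x0 \<in> B \<longleftrightarrow> B = root"
  using sole_root by (auto simp: sole_def)

section \<open>Entering a block along geodesics from the basepoint\<close>

definition entry_time :: "'a set \<Rightarrow> 'a \<Rightarrow> real" where
  "entry_time B z = Inf {t \<in> {0..}. toward x0 z t \<in> B}"

text \<open>Closedness of \<open>B\<close> makes the infimum attained; convexity keeps the geodesic
  in \<open>B\<close> from then on, since its end \<open>z\<close> is in \<open>B\<close>.\<close>

lemma entry_time_props:
  assumes B: "B \<in> \<B>" "B \<noteq> root" and z: "z \<in> B"
  shows "0 < entry_time B z" "entry_time B z \<le> dist x0 z"
    "\<And>t. 0 \<le> t \<Longrightarrow> toward x0 z t \<in> B \<longleftrightarrow> entry_time B z \<le> t"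
proof -
  let ?T = "{t \<in> {0..}. toward x0 z t \<in> B}"
  let ?a = "entry_time B z"
  have "closed ?T"
    using continuous_closed_preimage[OF continuous_on_toward closed_atLeast closed_block[OF B(1)]]
    by (simp add: vimage_def Int_def)
  moreover have end_in: "dist x0 z \<in> ?T"
    using z by (simp add: toward_far)
  then have "?T \<noteq> {}"
    by (metis empty_iff)
  moreover have bdd: "bdd_below ?T"
    by (rule bdd_belowI[of _ 0]) auto
  ultimately have a: "?a \<in> ?T"
    unfolding entry_time_def by (intro closed_contains_Inf)
  show "?a \<le> dist x0 z"
    unfolding entry_time_def using end_in bdd by (rule cInf_lower)
  have "?a \<noteq> 0"
    using a basepoint_in_iff B by auto
  with a show "0 < ?a"
    by auto
  fix t :: real assume t: "0 \<le> t"
  show "toward x0 z t \<in> B \<longleftrightarrow> ?a \<le> t"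
  proof
    assume "toward x0 z t \<in> B"
    then show "?a \<le> t"
      unfolding entry_time_def using t bdd by (intro cInf_lower) auto
  next
    assume le: "?a \<le> t"
    show "toward x0 z t \<in> B"
    proof (rule geodesically_convexD[OF convex_block[OF B(1)] _ z])
      show "toward x0 z ?a \<in> B"
        using a by simp
      have "toward x0 (toward x0 z t) ?a = toward x0 z ?a"
        using a le by (intro toward_toward) auto
      then show "dist (toward x0 z ?a) (toward x0 z t) + dist (toward x0 z t) z = dist (toward x0 z ?a) z"
        using a le t by (simp add: dist_toward_toward dist_toward min_def)
    qed
  qed
qed

text \<open>Close to the entry point all blocks contain it, so there is just one besides \<open>B\<close>.\<close>

lemma entry_neighbor:
  assumes B: "B \<in> \<B>" "B \<noteq> root" and z: "z \<in> B"
  shows "\<exists>P \<delta>. P \<in> \<B> \<and> P \<noteq> B \<and> toward x0 z (entry_time B z) \<in> P \<and> 0 < \<delta> \<and>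
    (\<forall>t\<ge>0. entry_time B z - \<delta> < t \<longrightarrow> t < entry_time B z \<longrightarrow> sole (toward x0 z t) P)"
proof -
  let ?a = "entry_time B z" and ?\<sigma> = "toward x0 z"
  note a = entry_time_props[OF assms]
  have aB: "?\<sigma> ?a \<in> B"
    using a by simp
  obtain \<delta> where \<delta>: "0 < \<delta>" "\<And>C y. C \<in> \<B> \<Longrightarrow> y \<in> C \<Longrightarrow> dist (?\<sigma> ?a) y < \<delta> \<Longrightarrow> ?\<sigma> ?a \<in> C"
    using near_blocks_contain_center by meson
  have near: "C \<noteq> B \<and> ?\<sigma> ?a \<in> C" if "0 \<le> t" "?a - \<delta> < t" "t < ?a" "C \<in> \<B>" "?\<sigma> t \<in> C" for t C
  proof -
    have "dist (?\<sigma> ?a) (?\<sigma> t) < \<delta>"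
      using that a(1,2) by (simp add: dist_toward_toward)
    then show ?thesis
      using \<delta>(2) that a(3) by auto
  qed
  define t where "t = max (?a / 2) (?a - \<delta> / 2)"
  have t: "0 \<le> t" "?a - \<delta> < t" "t < ?a"
    using a(1) \<delta>(1) by (auto simp: t_def)
  obtain P where P: "P \<in> \<B>" "?\<sigma> t \<in> P"
    using cover by blast
  have P': "P \<noteq> B" "?\<sigma> ?a \<in> P"
    using near[OF t P] by auto
  have "sole (?\<sigma> s) P" if "0 \<le> s" "?a - \<delta> < s" "s < ?a" for s
  proof -
    have "C = P" if "C \<in> \<B>" "?\<sigma> s \<in> C" for C
      using near[OF \<open>0 \<le> s\<close> \<open>?a - \<delta> < s\<close> \<open>s < ?a\<close> that] P P' B aB that
        at_most_two_blocks[of C P B "?\<sigma> ?a"] by blast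
    then show ?thesis
      using cover[of "?\<sigma> s"] P unfolding sole_def by blast
  qed
  then show ?thesis
    using P P' \<delta>(1) by (intro exI[of _ P] exI[of _ \<delta>]) simp
qed

text \<open>The description is unique because the entry point lies in \<open>B\<close> and no point
  lies in three blocks.\<close>

definition entered_from :: "'a set \<Rightarrow> 'a \<Rightarrow> 'a set" where
  "entered_from B z = (THE P. P \<in> \<B> \<and> P \<noteq> B \<and> toward x0 z (entry_time B z) \<in> P)"

lemma entered_from_eq:
  assumes B: "B \<in> \<B>" "B \<noteq> root" and z: "z \<in> B"
    and P: "P \<in> \<B>" "P \<noteq> B" "toward x0 z (entry_time B z) \<in> P"
  shows "entered_from B z = P"
  unfolding entered_from_def
proof (rule the_equality)
  have "toward x0 z (entry_time B z) \<in> B"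
    using entry_time_props[OF B z] by simp
  then show "Q = P" if "Q \<in> \<B> \<and> Q \<noteq> B \<and> toward x0 z (entry_time B z) \<in> Q" for Q
    using at_most_two_blocks[of Q P B] that P B by blast
qed (use P in blast)

text \<open>If \<open>z'\<close> is close to \<open>z\<close>, then the geodesic to \<open>z'\<close> stays close to \<open>B\<close> between its passage
  through the block from which the geodesic to \<open>z\<close> enters \<open>B\<close> and its own entry. The other
  blocks close to \<open>B\<close> intersect \<open>B\<close>, hence not each other, so it cannot change blocks there.\<close>

lemma entered_from_locally_constant:
  assumes B: "B \<in> \<B>" "B \<noteq> root" and z: "z \<in> B"
  shows "\<exists>d>0. \<forall>z'\<in>B. dist z z' < d \<longrightarrow> entered_from B z' = entered_from B z"
proof -
  let ?a = "entry_time B z" and ?\<sigma> = "toward x0 z"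
  note a = entry_time_props[OF assms]
  obtain \<epsilon> where \<epsilon>: "0 < \<epsilon>"
    "\<forall>B\<in>\<B>. \<forall>B'\<in>\<B>. \<forall>u\<in>B. \<forall>u'\<in>B'. \<forall>y. dist u y < \<epsilon> \<longrightarrow> dist u' y < \<epsilon> \<longrightarrow> B \<inter> B' \<noteq> {}"
    using separation by (elim exE conjE)
  obtain P \<delta> where P: "P \<in> \<B>" "P \<noteq> B" "?\<sigma> ?a \<in> P" and "0 < \<delta>"
    and sole: "\<forall>t\<ge>0. ?a - \<delta> < t \<longrightarrow> t < ?a \<longrightarrow> sole (?\<sigma> t) P"
    using entry_neighbor[OF assms] by (elim exE conjE)
  \<comment> \<open>At \<open>t1\<close> the geodesic to \<open>z\<close> lies in \<open>P\<close>
    alone, and from \<open>t1\<close> on it is within \<open>\<epsilon> / 2\<close> of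
    \<open>B\<close>.\<close>
  define t1 where "t1 = max (?a / 2) (?a - min \<delta> \<epsilon> / 2)"
  have t1: "0 \<le> t1" "?a - \<delta> < t1" "t1 < ?a" "?a - \<epsilon> / 2 \<le> t1"
    using a(1) \<open>0 < \<delta>\<close> \<epsilon>(1) by (auto simp: t1_def)
  obtain \<eta> where \<eta>: "0 < \<eta>" "\<And>y. dist (?\<sigma> t1) y < \<eta> \<Longrightarrow> sole y P"
    using sole_near[OF sole[rule_format, OF t1(1-3)]] by blast
  have PB: "P \<inter> B \<noteq> {}"
    using P a by auto
  show ?thesis
  proof (intro exI conjI ballI impI)
    \<comment> \<open>Geodesics move by at most twice the displacement of the end. Thus
      \<open>\<eta> / 2\<close> keeps the new geodesic in \<open>P\<close> alone at time
      \<open>t1\<close>, and \<open>\<epsilon> / 4\<close> adds less than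
      \<open>\<epsilon> / 2\<close> to its distance from \<open>B\<close>.\<close>
    show "0 < min (\<eta> / 2) (\<epsilon> / 4)"
      using \<eta> \<epsilon> by simp
    fix z' assume z': "z' \<in> B" and d: "dist z z' < min (\<eta> / 2) (\<epsilon> / 4)"
    let ?a' = "entry_time B z'" and ?\<sigma>' = "toward x0 z'"
    note a' = entry_time_props[OF B z']
    have close: "dist (?\<sigma> t) (?\<sigma>' t) < \<eta>" "dist (?\<sigma> t) (?\<sigma>' t) < \<epsilon> / 2" if "0 \<le> t" for t
      using dist_toward_le[OF that, of x0 z z'] d unfolding min_less_iff_conj by linarith+
    have soleP: "sole (?\<sigma>' t1) P"
      by (rule \<eta>(2)[OF close(1)[OF t1(1)]])
    then have P1: "?\<sigma>' t1 \<in> P"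
      unfolding sole_def by (elim conjE)
    have "?\<sigma>' t1 \<notin> B"
      using sole_unique[OF soleP B(1)] P(2) by metis
    then have "t1 < ?a'"
      using a'(3)[OF t1(1)] by simp
    have adj: "C \<inter> B \<noteq> {}" if "t1 \<le> t" "C \<in> \<B>" "?\<sigma>' t \<in> C" for t C
    proof (rule \<epsilon>(2)[rule_format, OF that(2) B(1) that(3)])
      let ?u = "?\<sigma> (max t ?a)"
      show "?u \<in> B"
        using a that t1 by simp
      have "dist ?u (?\<sigma> t) \<le> max t ?a - t"
        using that t1 a(1) by (simp add: dist_toward_toward)
      also have "\<dots> \<le> \<epsilon> / 2"
        using that t1 \<epsilon>(1) by auto
      finally show "dist ?u (?\<sigma>' t) < \<epsilon>"
        using close(2)[of t] that t1 dist_triangle[of ?u "?\<sigma>' t" "?\<sigma> t"] by simp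
    qed (use \<epsilon> in simp)
    have const: "?\<sigma>' t \<in> P" if "t \<in> {t1..<?a'}" for t
    proof -
      have "(?\<sigma>' t1 \<in> P) = (?\<sigma>' t \<in> P)"
      proof (rule connected_local_const[where A = "{t1..<?a'}"])
        show "\<forall>t\<in>{t1..<?a'}. \<forall>\<^sub>F s in at t within {t1..<?a'}. (?\<sigma>' t \<in> P) = (?\<sigma>' s \<in> P)"
        proof
          fix t assume t: "t \<in> {t1..<?a'}"
          obtain \<rho> where \<rho>: "0 < \<rho>" "\<And>C y. C \<in> \<B> \<Longrightarrow> y \<in> C \<Longrightarrow> dist (?\<sigma>' t) y < \<rho> \<Longrightarrow> ?\<sigma>' t \<in> C"
            using near_blocks_contain_center by meson
          have "(?\<sigma>' t \<in> P) = (?\<sigma>' s \<in> P)" if s: "s \<in> {t1..<?a'}" "dist s t < \<rho>" for s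
          proof -
            have d: "dist (?\<sigma>' t) (?\<sigma>' s) < \<rho>"
              using s t t1 by (auto simp: dist_toward_toward dist_real_def)
            obtain C where C: "C \<in> \<B>" "?\<sigma>' s \<in> C"
              using cover by blast
            have "C \<noteq> B"
              using C s a'(3)[of s] t1 by auto
            have tC: "?\<sigma>' t \<in> C"
              using \<rho>(2)[OF C d] .
            show ?thesis
            proof
              assume "?\<sigma>' t \<in> P"
              then have "C = P"
                using no_three_blocks[of C P B] C P B adj[OF _ C] s tC PB \<open>C \<noteq> B\<close> by auto
              then show "?\<sigma>' s \<in> P"
                using C by simp
            next
              assume "?\<sigma>' s \<in> P"
              then show "?\<sigma>' t \<in> P"
                using \<rho>(2)[OF P(1) _ d] by blast
            qed
          qed
          then show "\<forall>\<^sub>F s in at t within {t1..<?a'}. (?\<sigma>' t \<in> P) = (?\<sigma>' s \<in> P)"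
            unfolding eventually_at using \<rho>(1) by blast
        qed
      qed (use that \<open>t1 < ?a'\<close> in auto)
      with P1 show ?thesis
        by simp
    qed
    have "?\<sigma>' ?a' \<in> P"
    proof -
      obtain \<rho> where \<rho>: "0 < \<rho>" "\<And>C y. C \<in> \<B> \<Longrightarrow> y \<in> C \<Longrightarrow> dist (?\<sigma>' ?a') y < \<rho> \<Longrightarrow> ?\<sigma>' ?a' \<in> C"
        using near_blocks_contain_center by meson
      let ?t = "max t1 (?a' - \<rho> / 2)"
      have "dist (?\<sigma>' ?a') (?\<sigma>' ?t) < \<rho>"
        using t1 \<open>t1 < ?a'\<close> \<rho>(1) by (auto simp: dist_toward_toward)
      moreover have "?\<sigma>' ?t \<in> P"
        using \<open>t1 < ?a'\<close> \<rho>(1) by (intro const) auto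
      ultimately show ?thesis
        using \<rho>(2) P(1) by blast
    qed
    then show "entered_from B z' = entered_from B z"
      using entered_from_eq[OF B z' P(1,2)] entered_from_eq[OF B z P] by simp
  qed
qed

lemma connected_convex:
  assumes "geodesically_convex (C :: 'a set)"
  shows "connected C"
  unfolding connected_iff_connected_component
proof (intro ballI)
  fix y z assume yz: "y \<in> C" "z \<in> C"
  have "connected (toward y z ` {0..dist y z})"
    by (intro connected_continuous_image continuous_on_subset[OF continuous_on_toward]) auto
  moreover have "toward y z ` {0..dist y z} \<subseteq> C"
    using toward_in_convex[OF assms yz] by auto
  moreover have "y \<in> toward y z ` {0..dist y z}"
    by (rule image_eqI[of _ _ 0]) auto
  moreover have "z \<in> toward y z ` {0..dist y z}"
    by (rule image_eqI[of _ _ "dist y z"]) (auto simp: toward_far)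
  ultimately show "connected_component C y z"
    unfolding connected_component_def by blast
qed

text \<open>The choice of the point of \<open>B\<close> is immaterial by
  \<open>entered_from_parent\<close>.\<close>

definition parent :: "'a set \<Rightarrow> 'a set" where
  "parent B = entered_from B (SOME z. z \<in> B)"

lemma entered_from_parent:
  assumes B: "B \<in> \<B>" "B \<noteq> root" and z: "z \<in> B"
  shows "entered_from B z = parent B"
  unfolding parent_def
proof (rule connected_local_const[OF connected_convex[OF convex_block[OF B(1)]] z])
  show "(SOME z. z \<in> B) \<in> B"
    using z by (rule someI)
  show "\<forall>z\<in>B. \<forall>\<^sub>F z' in at z within B. entered_from B z = entered_from B z'"
    unfolding eventually_at using entered_from_locally_constant[OF B] by (metis dist_commute)
qed

lemma parent_props:
  assumes B: "B \<in> \<B>" "B \<noteq> root" and z: "z \<in> B"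
  shows "parent B \<in> \<B>" "parent B \<noteq> B" "toward x0 z (entry_time B z) \<in> parent B"
    "\<exists>\<delta>>0. \<forall>t\<ge>0. entry_time B z - \<delta> < t \<longrightarrow> t < entry_time B z \<longrightarrow> sole (toward x0 z t) (parent B)"
proof -
  obtain P \<delta> where P: "P \<in> \<B>" "P \<noteq> B" "toward x0 z (entry_time B z) \<in> P" "0 < \<delta>"
    "\<forall>t\<ge>0. entry_time B z - \<delta> < t \<longrightarrow> t < entry_time B z \<longrightarrow> sole (toward x0 z t) P"
    using entry_neighbor[OF assms] by (elim exE conjE)
  have "parent B = P"
    using entered_from_eq[OF assms P(1-3)] entered_from_parent[OF assms] by simp
  with P show "parent B \<in> \<B>" "parent B \<noteq> B" "toward x0 z (entry_time B z) \<in> parent B"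
    "\<exists>\<delta>>0. \<forall>t\<ge>0. entry_time B z - \<delta> < t \<longrightarrow> t < entry_time B z \<longrightarrow> sole (toward x0 z t) (parent B)"
    by blast+
qed

end

subsection \<open>Itineraries\<close>

context block_decomposed
begin

lemma sole_in: "sole y B \<Longrightarrow> B \<in> \<B>" "sole y B \<Longrightarrow> y \<in> B"
  by (simp_all add: sole_def)

lemma sole_eq: "sole y B \<Longrightarrow> sole y B' \<Longrightarrow> B = B'"
  by (simp add: sole_def)

lemma times_only_in_iff: "B \<in> \<B> \<Longrightarrow> t \<in> times_only_in \<B> c B \<longleftrightarrow> 0 \<le> t \<and> sole (c t) B"
  by (auto simp: times_only_in_def sole_def)

lemma ray_convex:
  fixes c :: "real \<Rightarrow> 'a"
  assumes "geodesic_ray c" "B \<in> \<B>" "c r \<in> B" "c t \<in> B" "0 \<le> r" "r \<le> s" "s \<le> t"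
  shows "c s \<in> B"
  using assms by (intro geodesically_convexD[OF convex_block[OF assms(2)] assms(3,4)])
    (simp add: geodesic_ray_dist)

context
  fixes c :: "real \<Rightarrow> 'a"
  assumes ray: "geodesic_ray c" and start: "c 0 = x0"
begin

text \<open>A ray that returns to a block has, by convexity, never left it in between. So the order
  of two blocks does not depend on the times at which they are observed.\<close>

lemma sole_order:
  assumes s: "0 \<le> s" "sole (c s) B'" and t: "0 \<le> t" "sole (c t) B" and "s < t" "B \<noteq> B'"
    and s': "0 \<le> s'" "sole (c s') B'" and t': "0 \<le> t'" "sole (c t') B"
  shows "s' < t'"
proof (rule ccontr)
  assume "\<not> s' < t'"
  moreover have "s' \<noteq> t'"
    using sole_eq s' t' \<open>B \<noteq> B'\<close> by metis
  ultimately have "t' < s'"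
    by simp
  show False
  proof (cases "t' \<le> s")
    case True
    have "c s \<in> B"
      by (rule ray_convex[OF ray sole_in(1)[OF t(2)] sole_in(2)[OF t'(2)] sole_in(2)[OF t(2)] t'(1)])
        (use True \<open>s < t\<close> in simp_all)
    then show False
      using sole_unique[OF s(2) sole_in(1)[OF t(2)]] \<open>B \<noteq> B'\<close> by simp
  next
    case False
    have "c t' \<in> B'"
      by (rule ray_convex[OF ray sole_in(1)[OF s(2)] sole_in(2)[OF s(2)] sole_in(2)[OF s'(2)] s(1)])
        (use False \<open>t' < s'\<close> in simp_all)
    then show False
      using sole_unique[OF t'(2) sole_in(1)[OF s(2)]] \<open>B \<noteq> B'\<close> by simp
  qed
qed

text \<open>By \<open>sole_order\<close> a single visiting time of \<open>B\<close> decides, and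
  later counts may choose whichever time is convenient.\<close>

lemma entered_before_eq:
  assumes t: "0 \<le> t" "sole (c t) B"
  shows "entered_before \<B> c B = {B' \<in> \<B> - {B}. \<exists>s\<ge>0. s < t \<and> sole (c s) B'}"
proof (intro set_eqI iffI)
  fix B' assume "B' \<in> entered_before \<B> c B"
  then obtain s u where B': "B' \<in> \<B>" "B' \<noteq> B" and su: "s \<in> times_only_in \<B> c B'" "u \<in> times_only_in \<B> c B" "s < u"
    unfolding entered_before_def by auto
  then have s: "0 \<le> s" "sole (c s) B'" and u: "0 \<le> u" "sole (c u) B"
    using times_only_in_iff sole_in(1)[OF t(2)] by auto
  have "s < t"
    using sole_order[OF s u su(3) B'(2)[symmetric] s t] .
  then show "B' \<in> {B' \<in> \<B> - {B}. \<exists>s\<ge>0. s < t \<and> sole (c s) B'}"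
    using B' s by auto
next
  fix B' assume B': "B' \<in> {B' \<in> \<B> - {B}. \<exists>s\<ge>0. s < t \<and> sole (c s) B'}"
  then obtain s where "0 \<le> s" "s < t" "sole (c s) B'"
    by auto
  then have "s \<in> times_only_in \<B> c B'" "t \<in> times_only_in \<B> c B"
    using B' t times_only_in_iff sole_in(1)[OF t(2)] by simp_all
  then show "B' \<in> entered_before \<B> c B"
    unfolding entered_before_def using B' \<open>s < t\<close> by auto
qed

lemma finite_entered_before:
  assumes t: "0 \<le> t" "sole (c t) B"
  shows "finite (entered_before \<B> c B)"
proof (rule finite_subset[OF _ finite_blocks_compact[OF compact_cball[of x0 t]]])
  show "entered_before \<B> c B \<subseteq> {B \<in> \<B>. B \<inter> cball x0 t \<noteq> {}}"
  proof
    fix B' assume "B' \<in> entered_before \<B> c B"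
    then obtain s where s: "B' \<in> \<B>" "0 \<le> s" "s < t" "sole (c s) B'"
      unfolding entered_before_eq[OF t] by auto
    moreover have "dist x0 (c s) = s"
      using geodesic_ray_dist[OF ray, of 0 s] s start by simp
    ultimately have "c s \<in> B' \<inter> cball x0 t"
      using sole_in by simp
    with s show "B' \<in> {B \<in> \<B>. B \<inter> cball x0 t \<noteq> {}}"
      by auto
  qed
qed

lemma enters_iff: "enters \<B> c B \<longleftrightarrow> (\<exists>t\<ge>0. sole (c t) B)"
proof
  assume "enters \<B> c B"
  then show "\<exists>t\<ge>0. sole (c t) B"
    unfolding enters_def using times_only_in_iff[of B _ c] by auto
next
  assume "\<exists>t\<ge>0. sole (c t) B"
  then obtain t where t: "0 \<le> t" "sole (c t) B"
    by auto
  then have "t \<in> times_only_in \<B> c B"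
    using times_only_in_iff sole_in by simp
  then show "enters \<B> c B"
    unfolding enters_def using sole_in(1)[OF t(2)] by auto
qed

lemma nth_entered_iff:
  "nth_entered \<B> c n B \<longleftrightarrow> (\<exists>t\<ge>0. sole (c t) B) \<and> card (entered_before \<B> c B) = n"
  unfolding nth_entered_def enters_iff using finite_entered_before by auto

lemma entered_before_mono:
  assumes t: "0 \<le> t" "sole (c t) B" and u: "sole (c u) B'" "t < u" and ne: "B \<noteq> B'"
  shows "insert B (entered_before \<B> c B) \<subseteq> entered_before \<B> c B'"
proof -
  have u0: "0 \<le> u"
    using t u by simp
  have "B' \<noteq> D" if "0 \<le> s" "s < t" "sole (c s) D" for s D
  proof
    assume "B' = D"
    then have "c s \<in> B'"
      using sole_in(2)[OF that(3)] by simp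
    then have "c t \<in> B'"
      by (rule ray_convex[OF ray sole_in(1)[OF u(1)] _ sole_in(2)[OF u(1)]]) (use that u in simp_all)
    then show False
      using sole_unique[OF t(2) sole_in(1)[OF u(1)]] ne by simp
  qed
  note before = this
  show ?thesis
  proof
    fix D assume "D \<in> insert B (entered_before \<B> c B)"
    then consider "D = B" | s where "0 \<le> s" "s < t" "sole (c s) D"
      unfolding entered_before_eq[OF t] by auto
    then obtain s where "0 \<le> s" "s < u" "sole (c s) D" "D \<noteq> B'"
    proof cases
      case 1
      then show ?thesis
        using that[of t] t u ne by simp
    next
      case (2 s)
      then show ?thesis
        using that[of s] before[OF 2] u by simp
    qed
    then show "D \<in> entered_before \<B> c B'"
      unfolding entered_before_eq[OF u0 u(1)] using sole_in(1) by auto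
  qed
qed

lemma not_entered_before_self: "B \<notin> entered_before \<B> c B"
  by (simp add: entered_before_def)

lemma card_entered_before_less:
  assumes "0 \<le> t" "sole (c t) B" "sole (c u) B'" "t < u" "B \<noteq> B'"
  shows "card (entered_before \<B> c B) < card (entered_before \<B> c B')"
proof (rule psubset_card_mono)
  show "finite (entered_before \<B> c B')"
    using assms by (intro finite_entered_before[of u]) auto
  show "entered_before \<B> c B \<subset> entered_before \<B> c B'"
  proof (rule psubsetI)
    show "entered_before \<B> c B \<subseteq> entered_before \<B> c B'"
      using entered_before_mono[OF assms] by (rule order_trans[OF subset_insertI])
    have "B \<in> entered_before \<B> c B'"
      using entered_before_mono[OF assms] by (rule subsetD) (rule insertI1)
    then show "entered_before \<B> c B \<noteq> entered_before \<B> c B'"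
      using not_entered_before_self[of B] by metis
  qed
qed

lemma nth_entered_unique:
  assumes "nth_entered \<B> c n B" "nth_entered \<B> c n B'"
  shows "B = B'"
proof (rule ccontr)
  assume ne: "B \<noteq> B'"
  obtain t u where t: "0 \<le> t" "sole (c t) B" "0 \<le> u" "sole (c u) B'"
    and card: "card (entered_before \<B> c B) = card (entered_before \<B> c B')"
    using assms unfolding nth_entered_iff by auto
  have "t \<noteq> u"
    using sole_eq t ne by metis
  then consider "t < u" | "u < t"
    by linarith
  then show False
    using card_entered_before_less[OF t(1,2,4) _ ne] card_entered_before_less[OF t(3,4,2) _ ne[symmetric]] card
    by cases auto
qed

lemma itinerary_eq: "nth_entered \<B> c n B \<Longrightarrow> itinerary \<B> c n = Some B"
  unfolding itinerary_def using nth_entered_unique by (auto intro!: the_equality)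

lemma nth_entered_root: "nth_entered \<B> c 0 root"
proof -
  have s: "sole (c 0) root"
    using sole_root start by simp
  have "entered_before \<B> c root = {}"
    unfolding entered_before_eq[OF order_refl s] by auto
  with s show ?thesis
    unfolding nth_entered_iff by auto
qed

text \<open>Immediately before its entry into \<open>B\<close> the ray lies in the parent alone, and
  every block entered earlier was visited before some such moment. Hence \<open>B\<close> has
  exactly one predecessor more than its parent.\<close>

lemma nth_entered_parent:
  assumes B: "nth_entered \<B> c n B" "B \<noteq> root"
  shows "\<exists>m. n = Suc m \<and> nth_entered \<B> c m (parent B)"
proof -
  obtain t where t: "0 \<le> t" "sole (c t) B" and n: "card (entered_before \<B> c B) = n"
    using B unfolding nth_entered_iff by auto
  have "B \<in> \<B>" "c t \<in> B"
    using t sole_in by auto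
  note Bt = this(1) B(2) this(2)
  let ?a = "entry_time B (c t)" and ?P = "parent B"
  have \<sigma>: "toward x0 (c t) s = c s" if "0 \<le> s" "s \<le> t" for s
    using toward_ray[OF ray, of s t] that t start by (simp add: min_def)
  have "dist x0 (c t) = t"
    using geodesic_ray_dist[OF ray, of 0 t] t start by simp
  then have a: "0 < ?a" "?a \<le> t"
    using entry_time_props[OF Bt] by auto
  have inB: "c s \<in> B \<longleftrightarrow> ?a \<le> s" if "0 \<le> s" "s \<le> t" for s
    using entry_time_props(3)[OF Bt that(1)] \<sigma>[OF that] by simp
  obtain \<delta> where \<delta>: "0 < \<delta>" and
    "\<forall>s\<ge>0. ?a - \<delta> < s \<longrightarrow> s < ?a \<longrightarrow> sole (toward x0 (c t) s) ?P"
    using parent_props(4)[OF Bt] by (elim exE conjE)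
  then have sole: "sole (c s) ?P" if "0 \<le> s" "?a - \<delta> < s" "s < ?a" for s
    using that \<sigma>[of s] a by auto
  define s where "s = max (?a / 2) (?a - \<delta> / 2)"
  have s: "0 \<le> s" "?a - \<delta> < s" "s < ?a"
    using a \<delta> by (auto simp: s_def)
  have sP: "sole (c s) ?P"
    by (rule sole[OF s])
  have PB: "?P \<noteq> B"
    by (rule parent_props(2)[OF Bt])
  have "s < t"
    using s a by simp
  have sub1: "insert ?P (entered_before \<B> c ?P) \<subseteq> entered_before \<B> c B"
    by (rule entered_before_mono[OF s(1) sP t(2) \<open>s < t\<close> PB])
  have sub2: "entered_before \<B> c B \<subseteq> insert ?P (entered_before \<B> c ?P)"
  proof
    fix D assume "D \<in> entered_before \<B> c B"
    then obtain r where D: "D \<noteq> B" and r: "0 \<le> r" "r < t" "sole (c r) D"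
      unfolding entered_before_eq[OF t] by auto
    have "c r \<notin> B"
      using sole_unique[OF r(3) Bt(1)] D by auto
    then have "r < ?a"
      using inB[of r] r by simp
    \<comment> \<open>A time later than \<open>r\<close> at which the ray is still in the parent
      alone.\<close>
    define s' where "s' = max ((r + ?a) / 2) s"
    have s': "0 \<le> s'" "?a - \<delta> < s'" "s' < ?a" "r < s'"
      using s \<open>r < ?a\<close> by (auto simp: s'_def less_max_iff_disj)
    show "D \<in> insert ?P (entered_before \<B> c ?P)"
      unfolding entered_before_eq[OF s'(1) sole[OF s'(1-3)]] using r s' sole_in(1)[OF r(3)] by auto
  qed
  have eq: "entered_before \<B> c B = insert ?P (entered_before \<B> c ?P)"
    by (rule subset_antisym[OF sub2 sub1])
  have "n = Suc (card (entered_before \<B> c ?P))"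
    unfolding n[symmetric] eq using finite_entered_before[OF s(1) sP] not_entered_before_self by simp
  moreover have "nth_entered \<B> c (card (entered_before \<B> c ?P)) ?P"
    unfolding nth_entered_iff using s(1) sP by auto
  ultimately show ?thesis
    by auto
qed

text \<open>Otherwise every point of the ray after \<open>T\<close> lies in exactly two blocks. Both
  blocks of a nearby point \<open>c s\<close> contain \<open>c t\<close>, so they are the two blocks
  of \<open>c t\<close>; this pair is locally constant, and the ray would remain in a block
  forever.\<close>

lemma sole_cofinal:
  assumes leaves: "\<forall>B\<in>\<B>. \<forall>T\<ge>0. \<exists>t\<ge>T. c t \<notin> B" and T: "0 \<le> T"
  shows "\<exists>t\<ge>T. \<exists>B. sole (c t) B"
proof (rule ccontr)
  assume "\<not> ?thesis"
  then have none: "\<not> sole (c t) B" if "T \<le> t" for t B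
    using that by auto
  obtain B where B: "B \<in> \<B>" "c T \<in> B"
    using cover by auto
  have "c t \<in> B" if "T \<le> t" for t
  proof -
    have "(c T \<in> B) = (c t \<in> B)"
    proof (rule connected_local_const[where A = "{T..}"])
      show "\<forall>t\<in>{T..}. \<forall>\<^sub>F s in at t within {T..}. (c t \<in> B) = (c s \<in> B)"
      proof
        fix t assume t: "t \<in> {T..}"
        obtain \<rho> where \<rho>: "0 < \<rho>" "\<forall>C\<in>\<B>. \<forall>y\<in>C. dist (c t) y < \<rho> \<longrightarrow> c t \<in> C"
          using near_blocks_contain_center[of "c t"] by auto
        have "(c t \<in> B) = (c s \<in> B)" if s: "s \<in> {T..}" "dist s t < \<rho>" for s
        proof -
          have d: "dist (c t) (c s) < \<rho>"
            using geodesic_ray_dist[OF ray, of t s] s t T by (simp add: dist_real_def)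
          have near: "c t \<in> C" if "C \<in> \<B>" "c s \<in> C" for C
            using \<rho>(2)[rule_format, OF that d] .
          obtain C1 where C1: "C1 \<in> \<B>" "c s \<in> C1"
            using cover by auto
          obtain C2 where C2: "C2 \<in> \<B>" "c s \<in> C2" "C2 \<noteq> C1"
            using none[of s C1] C1 s by (auto simp: sole_def)
          show ?thesis
          proof
            assume "c t \<in> B"
            then have "B = C1 \<or> B = C2"
              using at_most_two_blocks[OF C2(1) C1(1) B(1) near[OF C2(1,2)] near[OF C1]] C2(3) by auto
            then show "c s \<in> B"
              using C1 C2 by auto
          qed (rule near[OF B(1)])
        qed
        then show "\<forall>\<^sub>F s in at t within {T..}. (c t \<in> B) = (c s \<in> B)"
          unfolding eventually_at using \<rho>(1) by (intro exI[of _ \<rho>]) simp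
      qed
    qed (use that in auto)
    with B show ?thesis
      by simp
  qed
  then show False
    using leaves B(1) T by auto
qed

text \<open>Positions below an occupied one are occupied, by passing to parents
  (\<open>down\<close>). It therefore suffices to find a block entered after \<open>B\<close> has
  been left, and by convexity this block is not \<open>B\<close> again.\<close>

lemma nth_entered_exists:
  assumes leaves: "\<forall>B\<in>\<B>. \<forall>T\<ge>0. \<exists>t\<ge>T. c t \<notin> B"
  shows "\<exists>B. nth_entered \<B> c n B"
proof -
  have down: "\<exists>B. nth_entered \<B> c k B" if "nth_entered \<B> c m B" "k \<le> m" for k m B
    using that
  proof (induction m arbitrary: B)
    case 0
    then show ?case
      by auto
  next
    case (Suc m)
    show ?case
    proof (cases "k = Suc m")
      case True
      then show ?thesis
        using Suc.prems by auto
    next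
      case False
      have "B \<noteq> root"
        using Suc.prems(1) nth_entered_root by (auto simp: nth_entered_def)
      then show ?thesis
        using nth_entered_parent[OF Suc.prems(1)] Suc.IH[of "parent B"] Suc.prems(2) False by auto
    qed
  qed
  show ?thesis
  proof (induction n)
    case 0
    show ?case
      using nth_entered_root by auto
  next
    case (Suc n)
    then obtain B t where t: "0 \<le> t" "sole (c t) B" and n: "card (entered_before \<B> c B) = n"
      unfolding nth_entered_iff by auto
    obtain T where T: "t \<le> T" "c T \<notin> B"
      using leaves sole_in(1)[OF t(2)] t(1) by auto
    obtain u B' where u: "T \<le> u" "sole (c u) B'"
      using sole_cofinal[OF leaves, of T] T(1) t(1) by auto
    have "c t \<in> B"
      using t by (simp add: sole_in)
    then have "t < T"
      using T by (cases "t = T") auto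
    have "B \<noteq> B'"
    proof
      assume "B = B'"
      then have "c u \<in> B"
        using sole_in(2)[OF u(2)] by simp
      then have "c T \<in> B"
        by (rule ray_convex[OF ray sole_in(1)[OF t(2)] sole_in(2)[OF t(2)] _ t(1) T(1) u(1)])
      then show False
        using T(2) by simp
    qed
    then have "Suc n \<le> card (entered_before \<B> c B')"
      using card_entered_before_less[OF t u(2)] \<open>t < T\<close> u(1) n by simp
    moreover have "nth_entered \<B> c (card (entered_before \<B> c B')) B'"
      unfolding nth_entered_iff using u t(1) T(1) by (auto intro!: exI[of _ u])
    ultimately show ?case
      using down by auto
  qed
qed

end

section \<open>Infinite branches of the tree of blocks\<close>

definition block_chain :: "(nat \<Rightarrow> 'a set) \<Rightarrow> bool" where
  "block_chain Bs \<longleftrightarrow> Bs 0 = root \<and>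
    (\<forall>n. Bs n \<in> \<B> \<and> Bs (Suc n) \<noteq> root \<and> parent (Bs (Suc n)) = Bs n)"

lemma block_chainD:
  assumes "block_chain Bs"
  shows "Bs 0 = root" "Bs n \<in> \<B>" "Bs (Suc n) \<noteq> root" "parent (Bs (Suc n)) = Bs n"
  using assms unfolding block_chain_def by simp_all

text \<open>The root occurs only at index 0 and \<open>parent\<close> lowers the index by one, so a
  block determines its depth.\<close>

lemma block_chain_inj:
  assumes Bs: "block_chain Bs"
  shows "inj Bs"
proof -
  have "Bs i = Bs j \<Longrightarrow> i = j" for i j
  proof (induction i arbitrary: j)
    case 0
    then show ?case
      using block_chainD(1,3)[OF Bs] by (cases j) auto
  next
    case (Suc i)
    then obtain k where k: "j = Suc k"
      using block_chainD(1,3)[OF Bs] by (cases j) auto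
    then have "Bs i = Bs k"
      using Suc.prems block_chainD(4)[OF Bs, of i] block_chainD(4)[OF Bs, of k] by simp
    then show ?case
      using Suc.IH k by simp
  qed
  then show ?thesis
    by (rule injI)
qed

text \<open>Since depth is determined by the parents, mere inclusion of the blocks forces equality
  of the sequences. Limits of rays then need not keep track of any order of entry.\<close>

lemma block_chain_subset_eq:
  assumes Bs: "block_chain Bs" and Bs': "block_chain Bs'" and sub: "\<And>k. \<exists>l. Bs' k = Bs l"
  shows "Bs' = Bs"
proof
  fix k show "Bs' k = Bs k"
  proof (induction k)
    case 0
    show ?case
      using block_chainD(1)[OF Bs] block_chainD(1)[OF Bs'] by simp
  next
    case (Suc k)
    obtain l where l: "Bs' (Suc k) = Bs l"
      using sub by auto
    then obtain m where m: "l = Suc m"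
      using block_chainD(1)[OF Bs] block_chainD(3)[OF Bs', of k] by (cases l) auto
    then have "Bs k = Bs m"
      using l Suc.IH block_chainD(4)[OF Bs, of m] block_chainD(4)[OF Bs', of k] by simp
    then show ?case
      using injD[OF block_chain_inj[OF Bs], of k m] l m by simp
  qed
qed

lemma block_chain_far:
  assumes Bs: "block_chain Bs"
  shows "eventually (\<lambda>n. Bs n \<inter> cball x0 r = {}) sequentially"
proof -
  have "finite (Bs -` {B \<in> \<B>. B \<inter> cball x0 r \<noteq> {}})"
    by (rule finite_vimageI[OF finite_blocks_compact[OF compact_cball] block_chain_inj[OF Bs]])
  moreover have "Bs -` {B \<in> \<B>. B \<inter> cball x0 r \<noteq> {}} = {n. Bs n \<inter> cball x0 r \<noteq> {}}"
    using block_chainD(2)[OF Bs] by auto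
  ultimately have "eventually (\<lambda>n. \<not> Bs n \<inter> cball x0 r \<noteq> {}) cofinite"
    by (simp add: eventually_cofinite)
  then show ?thesis
    by (simp add: cofinite_eq_sequentially)
qed

text \<open>Before its entry into \<open>Bs (Suc N)\<close> the geodesic coincides with the one to
  the entry point. That point lies in the parent \<open>Bs N\<close>, and the induction continues
  there.\<close>

lemma sole_on_geodesic_to_chain:
  assumes Bs: "block_chain Bs" and q: "q \<in> Bs N" and t: "0 \<le> t" and D: "sole (toward x0 q t) D"
  shows "\<exists>l\<le>N. D = Bs l"
  using q t D
proof (induction N arbitrary: q)
  case 0
  then have "toward x0 q t \<in> root"
    using toward_in_convex[OF convex_block[OF root_in] basepoint_in_root] block_chainD(1)[OF Bs] by simp
  then show ?case
    using sole_unique[OF 0(3) root_in] block_chainD(1)[OF Bs] by auto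
next
  case (Suc N)
  let ?B = "Bs (Suc N)" and ?a = "entry_time (Bs (Suc N)) q"
  note B = block_chainD(2)[OF Bs] block_chainD(3)[OF Bs] Suc.prems(1)
  note a = entry_time_props[OF B]
  show ?case
  proof (cases "?a \<le> t")
    case True
    then have "toward x0 q t \<in> ?B"
      using a(3) t by simp
    then have "D = ?B"
      using sole_unique[OF Suc.prems(3) B(1)] by simp
    then show ?thesis
      by auto
  next
    case False
    have e: "toward x0 q ?a \<in> Bs N"
      using parent_props(3)[OF B] block_chainD(4)[OF Bs] by simp
    have "toward x0 (toward x0 q ?a) t = toward x0 q t"
      using False t by (intro toward_toward) auto
    then have "\<exists>l\<le>N. D = Bs l"
      using Suc.IH[OF e t] Suc.prems(3) by simp
    then show ?thesis
      by (auto intro: le_SucI)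
  qed
qed

lemma irrational_chain:
  assumes \<alpha>: "\<alpha> \<in> visual_boundary" and irr: "irrational \<B> x0 \<alpha>"
  shows "\<exists>Bs. block_chain Bs \<and> boundary_itinerary \<B> x0 \<alpha> = (\<lambda>n. Some (Bs n)) \<and>
    (\<forall>n. \<exists>t\<ge>0. sole (ray_from x0 \<alpha> t) (Bs n))"
proof -
  note c = ray_from(3,2)[OF \<alpha>, of x0]
  let ?c = "ray_from x0 \<alpha>"
  have "\<exists>B. nth_entered \<B> ?c n B" for n
    using irr unfolding irrational_def boundary_itinerary_def itinerary_def by (meson option.distinct(1))
  then obtain Bs where Bs: "\<And>n. nth_entered \<B> ?c n (Bs n)"
    by metis
  have root: "Bs 0 = root"
    using nth_entered_unique[OF c Bs nth_entered_root[OF c]] .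
  have sole: "\<exists>t\<ge>0. sole (?c t) (Bs n)" for n
    using Bs[of n] unfolding nth_entered_iff[OF c] by auto
  then have "Bs n \<in> \<B>" for n
    using sole_in(1) by auto
  moreover have nr: "Bs (Suc n) \<noteq> root" for n
    using Bs[of "Suc n"] nth_entered_root[OF c] by (auto simp: nth_entered_def)
  moreover have "parent (Bs (Suc n)) = Bs n" for n
    using nth_entered_parent[OF c Bs nr] nth_entered_unique[OF c _ Bs[of n]] by auto
  ultimately have "block_chain Bs"
    using root by (simp add: block_chain_def)
  moreover have "boundary_itinerary \<B> x0 \<alpha> = (\<lambda>n. Some (Bs n))"
    unfolding boundary_itinerary_def using itinerary_eq[OF c Bs] by auto
  ultimately show ?thesis
    using sole by auto
qed

lemma rational_in_block_boundary:
  assumes \<alpha>: "\<alpha> \<in> visual_boundary" and rat: "\<not> irrational \<B> x0 \<alpha>"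
  shows "\<exists>B\<in>\<B>. \<alpha> \<in> boundary_of B"
proof -
  note c = ray_from(3,2)[OF \<alpha>, of x0]
  let ?c = "ray_from x0 \<alpha>"
  obtain n where "itinerary \<B> ?c n = None"
    using rat unfolding irrational_def boundary_itinerary_def by auto
  then have "\<not> (\<exists>B. nth_entered \<B> ?c n B)"
    using itinerary_eq[OF c] by auto
  then have "\<not> (\<forall>B\<in>\<B>. \<forall>T\<ge>0. \<exists>t\<ge>T. ?c t \<notin> B)"
    using nth_entered_exists[OF c, of n] by argo
  then obtain B T where B: "B \<in> \<B>" "0 \<le> T" "\<And>t. T \<le> t \<Longrightarrow> ?c t \<in> B"
    by auto
  \<comment> \<open>The tail of the ray inside \<open>B\<close>: shifting time by \<open>T\<close>
    moves points by the constant distance \<open>T\<close>, so it represents the same boundary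
    point.\<close>
  let ?d = "\<lambda>t. ?c (T + t)"
  have d: "geodesic_ray ?d"
    using c(1) B(2) by (simp add: geodesic_ray_def)
  have "dist (?c t) (?d t) \<le> T" if "0 \<le> t" for t
    using geodesic_ray_dist[OF c(1), of t "T + t"] B(2) that by simp
  then have "?d \<in> endpoint ?c"
    by (rule mem_endpointI[OF c(1) d])
  then have "?d \<in> \<alpha>"
    using boundary_eq_endpoint[OF \<alpha> ray_from(1)[OF \<alpha>]] by metis
  moreover have "?d ` {0..} \<subseteq> B"
    using B(3) by auto
  ultimately show ?thesis
    using B(1) \<alpha> unfolding boundary_of_def by auto
qed

text \<open>Each block that the limit ray enters is also entered by some geodesic to a point of the
  chain, as \<open>sole\<close> is open. So it belongs to the chain, and inclusion is enough by
  \<open>block_chain_subset_eq\<close>.\<close>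

lemma limit_itinerary:
  assumes Bs: "block_chain Bs" and \<beta>: "\<beta> \<in> visual_boundary" "irrational \<B> x0 \<beta>"
    and U: "U \<noteq> bot" and q: "\<And>i. q i \<in> Bs (N i)"
    and lim: "\<And>r. 0 \<le> r \<Longrightarrow> ((\<lambda>i. toward x0 (q i) r) \<longlongrightarrow> ray_from x0 \<beta> r) U"
  shows "boundary_itinerary \<B> x0 \<beta> = (\<lambda>n. Some (Bs n))"
proof -
  obtain Cs where Cs: "block_chain Cs" "boundary_itinerary \<B> x0 \<beta> = (\<lambda>n. Some (Cs n))"
    "\<forall>n. \<exists>t\<ge>0. sole (ray_from x0 \<beta> t) (Cs n)"
    using irrational_chain[OF \<beta>] by (elim exE conjE)
  have "\<exists>l. Cs k = Bs l" for k
  proof -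
    obtain t where t: "0 \<le> t" "sole (ray_from x0 \<beta> t) (Cs k)"
      using Cs(3) by auto
    obtain \<delta> where \<delta>: "0 < \<delta>" "\<forall>z. dist (ray_from x0 \<beta> t) z < \<delta> \<longrightarrow> sole z (Cs k)"
      using sole_near[OF t(2)] by auto
    have "eventually (\<lambda>i. dist (toward x0 (q i) t) (ray_from x0 \<beta> t) < \<delta>) U"
      using tendstoD[OF lim[OF t(1)] \<delta>(1)] .
    then obtain i where "dist (toward x0 (q i) t) (ray_from x0 \<beta> t) < \<delta>"
      using eventually_happens' U by blast
    then have "sole (toward x0 (q i) t) (Cs k)"
      using \<delta>(2) by (simp add: dist_commute)
    from sole_on_geodesic_to_chain[OF Bs q t(1) this] show ?thesis
      by auto
  qed
  from block_chain_subset_eq[OF Bs Cs(1) this] show ?thesis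
    using Cs(2) by simp
qed

end

subsection \<open>Paths between limits of receding convex sets\<close>

context proper_CAT0
begin

lemma nearest_point_exists:
  fixes C :: "'a set"
  assumes "closed C" "y \<in> C"
  shows "\<exists>m\<in>C. \<forall>z\<in>C. dist x m \<le> dist x z"
proof -
  have "compact (C \<inter> cball x (dist x y))"
    using assms(1) compact_cball by (rule closed_Int_compact)
  moreover have "C \<inter> cball x (dist x y) \<noteq> {}"
    using assms(2) by (metis IntI dist_commute empty_iff mem_cball order_refl)
  moreover have "continuous_on (C \<inter> cball x (dist x y)) (dist x)"
    by (intro continuous_intros)
  ultimately obtain m where m: "m \<in> C \<inter> cball x (dist x y)"
    "\<forall>z\<in>C \<inter> cball x (dist x y). dist x m \<le> dist x z"
    using continuous_attains_inf by metis
  have "dist x m \<le> dist x z" if "z \<in> C" for z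
    using m that by (cases "dist x z \<le> dist x y") auto
  with m(1) show ?thesis
    by auto
qed

text \<open>The angle at the nearest point is not acute, written as a Pythagorean inequality. If it
  failed, a short step from \<open>m\<close> toward \<open>y\<close> would lead to a point of
  \<open>C\<close> closer to \<open>x\<close>.\<close>

lemma nearest_point_obtuse:
  fixes C :: "'a set"
  assumes C: "geodesically_convex C" and m: "m \<in> C" "\<forall>z\<in>C. dist x m \<le> dist x z" and y: "y \<in> C"
  shows "(dist x m)\<^sup>2 + (dist m y)\<^sup>2 \<le> (dist x y)\<^sup>2"
proof (rule ccontr)
  assume "\<not> ?thesis"
  then have less: "(dist x y)\<^sup>2 - (dist x m)\<^sup>2 < (dist m y)\<^sup>2" (is "?k < ?d")
    by simp
  have "0 \<le> ?k"
    using m(2) y by (simp add: power_mono)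
  then have d: "0 < ?d"
    using less by linarith
  \<comment> \<open>The minimiser of \<open>l * (?k - (1 - l) * ?d)\<close>, by which Stewart bounds
    the change of the squared distance from \<open>x\<close>.\<close>
  define l where "l = (?d - ?k) / (2 * ?d)"
  have "?d - ?k \<le> 1 * (2 * ?d)"
    using \<open>0 \<le> ?k\<close> d by linarith
  then have l: "0 < l" "l \<le> 1"
    unfolding l_def using d less by (simp_all only: pos_divide_le_eq) simp_all
  have ld: "0 \<le> l * dist m y" "l * dist m y \<le> dist m y"
    using l by (auto simp: mult_left_le_one_le)
  define w where "w = toward m y (l * dist m y)"
  have "dist m w = l * dist m y" "dist w y = (1 - l) * dist m y"
    unfolding w_def using ld by (simp_all add: dist_toward left_diff_distrib)
  then have "(dist x w)\<^sup>2 \<le> (1 - l) * (dist x m)\<^sup>2 + l * (dist x y)\<^sup>2 - l * (1 - l) * ?d"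
    using l by (intro stewart) auto
  moreover have "w \<in> C"
    unfolding w_def using C m(1) y ld by (intro toward_in_convex)
  then have "(dist x m)\<^sup>2 \<le> (dist x w)\<^sup>2"
    using m(2) by (simp add: power_mono)
  moreover have "(1 - l) * (dist x m)\<^sup>2 + l * (dist x y)\<^sup>2 - l * (1 - l) * ?d =
      (dist x m)\<^sup>2 + l * (?k - (1 - l) * ?d)"
    by (simp add: algebra_simps)
  ultimately have "0 \<le> l * (?k - (1 - l) * ?d)"
    by linarith
  then have "?d - l * ?d \<le> ?k"
    using l(1) by (simp add: zero_le_mult_iff left_diff_distrib)
  moreover have "2 * (l * ?d) = ?d - ?k"
    using d by (simp add: l_def)
  moreover have False if "D - b \<le> k" "2 * b = D - k" "k < D" for b D k :: real
    using that by linarith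
  ultimately show False
    using less by metis
qed

text \<open>The computation gives \<open>sqrt 2 * dist x m\<close>, and 3/2 is a convenient rational
  above it. What matters is to stay below 2, where the segment could run through
  \<open>x\<close>.\<close>

lemma dist_nearest_point_toward:
  fixes C :: "'a set"
  assumes C: "geodesically_convex C" and m: "m \<in> C" "\<forall>z\<in>C. dist x m \<le> dist x z" and y: "y \<in> C"
  shows "dist m (toward x y (dist x m)) \<le> 3 / 2 * dist x m"
proof (cases "m = x")
  case True
  then show ?thesis
    by simp
next
  case False
  define h \<rho> l where "h = dist x m" and "\<rho> = dist x y" and "l = h / \<rho>"
  have h: "0 < h" "h \<le> \<rho>"
    using False m(2) y by (auto simp: h_def \<rho>_def)
  then have l: "0 \<le> l" "l \<le> 1" "l * \<rho> = h"
    by (auto simp: l_def)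
  let ?v = "toward x y h"
  have "dist x ?v = l * \<rho>" "dist ?v y = (1 - l) * \<rho>"
    using h l(3) by (simp_all add: dist_toward \<rho>_def left_diff_distrib)
  then have "(dist m ?v)\<^sup>2 \<le> (1 - l) * h\<^sup>2 + l * (dist m y)\<^sup>2 - l * (1 - l) * \<rho>\<^sup>2"
    using stewart[OF l(1,2), of x ?v y m] unfolding \<rho>_def h_def dist_commute[of x m] by blast
  also have "\<dots> \<le> (1 - l) * h\<^sup>2 + l * (\<rho>\<^sup>2 - h\<^sup>2) - l * (1 - l) * \<rho>\<^sup>2"
  proof -
    have "(dist m y)\<^sup>2 \<le> \<rho>\<^sup>2 - h\<^sup>2"
      using nearest_point_obtuse[OF C m y] by (simp add: h_def \<rho>_def)
    then show ?thesis
      using l(1) by (simp add: mult_left_mono)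
  qed
  also have "\<dots> = h\<^sup>2 - 2 * l * h\<^sup>2 + (l * \<rho>)\<^sup>2"
    by (simp add: algebra_simps power2_eq_square)
  also have "\<dots> \<le> 2 * h\<^sup>2"
  proof -
    have "0 \<le> l * h\<^sup>2"
      using l(1) by simp
    then show ?thesis
      unfolding l(3) by linarith
  qed
  also have "\<dots> \<le> (3 / 2 * h)\<^sup>2"
    by (simp add: power_mult_distrib power2_eq_square)
  finally have "(dist m ?v)\<^sup>2 \<le> (3 / 2 * h)\<^sup>2" .
  then have "dist m ?v \<le> 3 / 2 * h"
    by (rule power2_le_imp_le) (use h(1) in simp)
  then show ?thesis
    by (simp add: h_def)
qed

text \<open>Each point of the segment is within \<open>3 / 4 * h\<close> of an end, hence at least
  \<open>h / 4\<close> from \<open>x\<close>. Contraction from \<open>h / 4\<close> to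
  \<open>r\<close> has factor \<open>8 * r / h\<close>, which multiplied by the length
  \<open>3 / 2 * h\<close> gives \<open>12 * r\<close>, independent of \<open>h\<close>.\<close>

lemma radial_projection_of_segment:
  fixes x m v :: 'a
  assumes h: "dist x m = h" "dist x v = h" "0 < h" and mv: "dist m v \<le> 3 / 2 * h"
    and s: "0 \<le> s" "s \<le> 1" and s': "0 \<le> s'" "s' \<le> 1"
  shows "h / 4 \<le> dist x (toward m v (s * dist m v))"
    and "0 \<le> r \<Longrightarrow> r \<le> h / 4 \<Longrightarrow> dist (toward x (toward m v (s * dist m v)) r)
      (toward x (toward m v (s' * dist m v)) r) \<le> 12 * r * \<bar>s - s'\<bar>"
proof -
  have far: "h / 4 \<le> dist x (toward m v (s * dist m v))" if "0 \<le> s" "s \<le> 1" for s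
  proof -
    let ?u = "toward m v (s * dist m v)"
    have "dist m ?u + dist ?u v = dist m v"
      using that by (simp add: dist_toward)
    then have "dist m ?u \<le> 3 / 4 * h \<or> dist ?u v \<le> 3 / 4 * h"
      using mv by linarith
    then show ?thesis
      using dist_triangle[of x m ?u] dist_triangle[of x v ?u] h by (auto simp: dist_commute)
  qed
  then show "h / 4 \<le> dist x (toward m v (s * dist m v))"
    using s by simp
  assume r: "0 \<le> r" "r \<le> h / 4"
  let ?u = "toward m v (s * dist m v)" and ?u' = "toward m v (s' * dist m v)"
  have "s * dist m v \<le> dist m v" "s' * dist m v \<le> dist m v"
    using s s' by (simp_all add: mult_left_le_one_le)
  then have "dist ?u ?u' = \<bar>s * dist m v - s' * dist m v\<bar>"
    using s s' by (simp add: dist_toward_toward min_def)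
  also have "\<dots> = \<bar>s - s'\<bar> * dist m v"
    by (simp add: abs_mult flip: left_diff_distrib)
  also have "\<dots> \<le> \<bar>s - s'\<bar> * (3 / 2 * h)"
    using mv by (intro mult_left_mono) auto
  finally have uu: "dist ?u ?u' \<le> \<bar>s - s'\<bar> * (3 / 2 * h)" .
  have "dist (toward x ?u r) (toward x ?u' r) \<le> 2 * r / (h / 4) * dist ?u ?u'"
    using r h(3) far[OF s] far[OF s'] by (intro dist_toward_scaled) auto
  also have "\<dots> \<le> 2 * r / (h / 4) * (\<bar>s - s'\<bar> * (3 / 2 * h))"
    using uu r h(3) by (intro mult_left_mono) auto
  also have "\<dots> = 12 * r * \<bar>s - s'\<bar>"
    using h(3) by simp
  finally show "dist (toward x ?u r) (toward x ?u' r) \<le> 12 * r * \<bar>s - s'\<bar>" .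
qed

text \<open>The Lipschitz bound \<open>12 * r\<close> is the same for all \<open>i\<close>, so it
  survives the pointwise limit along \<open>U\<close>.\<close>

lemma segment_limit_path:
  fixes x :: 'a
  assumes U: "U \<noteq> bot"
    and h: "\<And>i. dist x (m i) = h i" "\<And>i. dist x (v i) = h i" "\<And>r. eventually (\<lambda>i. r \<le> h i) U"
    and mv: "\<And>i. dist (m i) (v i) \<le> 3 / 2 * h i"
    and lim: "\<And>s r. 0 \<le> s \<Longrightarrow> s \<le> 1 \<Longrightarrow> 0 \<le> r \<Longrightarrow>
      ((\<lambda>i. toward x (toward (m i) (v i) (s * dist (m i) (v i))) r) \<longlongrightarrow> g s r) U"
  shows "\<And>s. 0 \<le> s \<Longrightarrow> s \<le> 1 \<Longrightarrow> geodesic_ray (g s) \<and> g s 0 = x"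
    and "path_component_of (cone_topology x) (endpoint (g 0)) (endpoint (g 1))"
proof -
  let ?u = "\<lambda>s i. toward (m i) (v i) (s * dist (m i) (v i))"
  have ray: "geodesic_ray (g s) \<and> g s 0 = x" if s: "0 \<le> s" "s \<le> 1" for s
  proof -
    have "eventually (\<lambda>i. r \<le> dist x (?u s i)) U" for r
      using h(3)[of "4 * r"] h(3)[of 1]
    proof eventually_elim
      case (elim i)
      then have "h i / 4 \<le> dist x (?u s i)"
        by (intro radial_projection_of_segment(1)[OF h(1,2) _ mv s s]) simp
      then show ?case
        using elim by simp
    qed
    from limit_is_ray[OF U this lim[OF s]] show ?thesis
      by simp
  qed
  then show "\<And>s. 0 \<le> s \<Longrightarrow> s \<le> 1 \<Longrightarrow> geodesic_ray (g s) \<and> g s 0 = x" .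
  have lip: "dist (g s r) (g s' r) \<le> 12 * r * \<bar>s - s'\<bar>"
    if s: "0 \<le> s" "s \<le> 1" and s': "0 \<le> s'" "s' \<le> 1" and r: "0 \<le> r" for s s' r
  proof (rule tendsto_upperbound)
    show "((\<lambda>i. dist (toward x (?u s i) r) (toward x (?u s' i) r)) \<longlongrightarrow> dist (g s r) (g s' r)) U"
      by (intro tendsto_dist lim s s' r)
    show "eventually (\<lambda>i. dist (toward x (?u s i) r) (toward x (?u s' i) r) \<le> 12 * r * \<bar>s - s'\<bar>) U"
      using h(3)[of "4 * r"] h(3)[of 1]
    proof eventually_elim
      case (elim i)
      then show ?case
        using r by (intro radial_projection_of_segment(2)[OF h(1,2) _ mv s s']) auto
    qed
  qed (rule U)
  have eq: "ray_from x (endpoint (g s)) r = g s r" if "0 \<le> s" "s \<le> 1" "0 \<le> r" for s r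
    using ray_from_endpoint[of "g s" r] ray[OF that(1,2)] that(3) by metis
  have "pathin (cone_topology x) (\<lambda>s. endpoint (g s))"
    unfolding pathin_cone_topology
  proof (intro conjI allI impI)
    show "(\<lambda>s. endpoint (g s)) \<in> {0..1} \<rightarrow> visual_boundary"
      by (simp add: ray endpoint_in_boundary)
    fix r :: real assume r: "0 < r"
    have "continuous_on {0..1} (\<lambda>s. g s r)"
    proof (rule continuous_onI)
      fix s e :: real assume s: "s \<in> {0..1}" and e: "0 < e"
      have "dist (g s' r) (g s r) \<le> e" if "s' \<in> {0..1}" "dist s' s < e / (12 * r)" for s'
      proof -
        have "dist (g s' r) (g s r) \<le> 12 * r * \<bar>s' - s\<bar>"
          using lip that s r by simp
        also have "\<dots> \<le> 12 * r * (e / (12 * r))"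
          using that(2) r by (intro mult_left_mono) (auto simp: dist_real_def)
        finally show ?thesis
          using r by simp
      qed
      then show "\<exists>d>0. \<forall>s'\<in>{0..1}. dist s' s < d \<longrightarrow> dist (g s' r) (g s r) \<le> e"
        using r e by (intro exI[of _ "e / (12 * r)"]) simp
    qed
    then show "continuous_on {0..1} (\<lambda>s. ray_from x (endpoint (g s)) r)"
      by (rule continuous_on_eq) (use eq r in auto)
  qed
  then show "path_component_of (cone_topology x) (endpoint (g 0)) (endpoint (g 1))"
    unfolding path_component_of_def by (intro exI[of _ "\<lambda>s. endpoint (g s)"]) simp
qed

text \<open>Both endpoints are joined to the limit of the nearest points \<open>m i\<close>. As the angle at \<open>m i\<close>
  is not acute, the angles at \<open>x\<close> are not obtuse, so that the segments to be projected keep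
  their distance from \<open>x\<close>.\<close>

lemma limits_from_receding_convex_sets:
  fixes x :: 'a and C :: "nat \<Rightarrow> 'a set"
  assumes C: "\<And>i. closed (C i)" "\<And>i. geodesically_convex (C i)"
    and pq: "\<And>i. p i \<in> C i" "\<And>i. q i \<in> C i"
    and far: "\<And>r. eventually (\<lambda>i. C i \<inter> cball x r = {}) sequentially"
  shows "\<exists>U \<xi> \<eta>. U \<noteq> bot \<and> U \<le> sequentially \<and> \<xi> \<in> visual_boundary \<and> \<eta> \<in> visual_boundary \<and>
    (\<forall>r\<ge>0. ((\<lambda>i. toward x (p i) r) \<longlongrightarrow> ray_from x \<xi> r) U) \<and>
    (\<forall>r\<ge>0. ((\<lambda>i. toward x (q i) r) \<longlongrightarrow> ray_from x \<eta> r) U) \<and>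
    path_component_of (cone_topology x) \<xi> \<eta>"
proof -
  have "\<exists>m\<in>C i. \<forall>z\<in>C i. dist x m \<le> dist x z" for i
    by (rule nearest_point_exists[OF C(1) pq(1)])
  then obtain m where m: "\<And>i. m i \<in> C i" "\<And>i. \<forall>z\<in>C i. dist x (m i) \<le> dist x z"
    by metis
  define h where "h i = dist x (m i)" for i
  define e where "e b i = (if b then q i else p i)" for b i
  define v where "v b i = toward x (e b i) (h i)" for b i
  define u where "u b s i = toward (m i) (v b i) (s * dist (m i) (v b i))" for b s i
  \<comment> \<open>One index set for both ends \<open>b\<close>, all positions \<open>s\<close> on
    the segment and all radii \<open>r\<close>, so that a single filter serves every limit.\<close>
  define F where "F i = (\<lambda>(b, s, r). toward x (u b s i) (max 0 r))" for i
  have e: "e b i \<in> C i" for b i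
    using pq by (simp add: e_def)
  have v: "dist x (v b i) = h i" for b i
    using m(2)[of i] e[of b i] by (simp add: v_def dist_toward h_def)
  have mv: "dist (m i) (v b i) \<le> 3 / 2 * h i" for b i
    unfolding v_def h_def by (rule dist_nearest_point_toward[OF C(2) m e])
  obtain U G where U: "U \<noteq> bot" "U \<le> sequentially" and G: "\<And>j. ((\<lambda>i. F i j) \<longlongrightarrow> G j) U"
  proof (rule compact_coordinatewise_limit[of "\<lambda>(b, s, r). cball x (max 0 r)" F])
    show "compact (case j of (b, s, r) \<Rightarrow> cball x (max 0 r))" for j :: "bool \<times> real \<times> real"
      by (cases j) (simp add: compact_cball)
    show "F i j \<in> (case j of (b, s, r) \<Rightarrow> cball x (max 0 r))" for i j
      by (cases j) (simp add: F_def dist_toward)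
  qed (rule that)
  define g where "g b s r = G (b, s, r)" for b s r
  have lim: "((\<lambda>i. toward x (u b s i) r) \<longlongrightarrow> g b s r) U" if "0 \<le> r" for b s r
    using G[of "(b, s, r)"] that by (simp add: F_def g_def)
  have large: "eventually (\<lambda>i. r \<le> h i) U" for r
  proof -
    have "eventually (\<lambda>i. r \<le> h i) sequentially"
      using far[of r]
    proof eventually_elim
      case (elim i)
      then have "m i \<notin> cball x r"
        using m(1)[of i] by auto
      then show ?case
        by (simp add: h_def)
    qed
    then show ?thesis
      by (rule filter_leD[OF U(2)])
  qed
  have path: "path_component_of (cone_topology x) (endpoint (g b 0)) (endpoint (g b 1))"
    and ray: "geodesic_ray (g b 1) \<and> g b 1 0 = x"
    for b
  proof -
    have "path_component_of (cone_topology x) (endpoint (g b 0)) (endpoint (g b 1)) \<and> geodesic_ray (g b 1) \<and> g b 1 0 = x"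
      using segment_limit_path[where g = "g b" and v = "v b", OF U(1) h_def[symmetric] v large mv
        lim[unfolded u_def]] by simp
    then show "path_component_of (cone_topology x) (endpoint (g b 0)) (endpoint (g b 1))"
      "geodesic_ray (g b 1) \<and> g b 1 0 = x"
      by simp_all
  qed
  \<comment> \<open>At \<open>s = 0\<close> both curves point toward \<open>m i\<close>; here the
    two limit paths are joined.\<close>
  have "F i (True, 0, r) = F i (False, 0, r)" for i r
    by (simp add: F_def u_def)
  then have "g True 0 = g False 0"
    using tendsto_unique[OF U(1) G[of "(True, 0, _)"]] G[of "(False, 0, _)"] by (auto simp: g_def fun_eq_iff)
  then have "path_component_of (cone_topology x) (endpoint (g False 1)) (endpoint (g True 1))"
    using path[of True] path[of False] path_component_of_sym path_component_of_trans by metis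
  moreover have "((\<lambda>i. toward x (e b i) r) \<longlongrightarrow> ray_from x (endpoint (g b 1)) r) U" if r: "0 \<le> r" for b r
  proof -
    have "ray_from x (endpoint (g b 1)) r = g b 1 r"
      using ray_from_endpoint[of "g b 1" r] ray[of b] r by metis
    \<comment> \<open>The point \<open>v b i\<close> is on the geodesic to \<open>e b i\<close> at
      distance \<open>h i\<close>; once \<open>r \<le> h i\<close>, cutting there does not change
      the point at radius \<open>r\<close>.\<close>
    moreover have "eventually (\<lambda>i. toward x (u b 1 i) r = toward x (e b i) r) U"
      using large[of r]
    proof eventually_elim
      case (elim i)
      have "u b 1 i = v b i"
        by (simp add: u_def toward_far)
      then show ?case
        unfolding v_def using toward_toward[OF r elim] by simp
    qed
    then have "((\<lambda>i. toward x (e b i) r) \<longlongrightarrow> g b 1 r) U"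
      by (rule Lim_transform_eventually[OF lim[OF r]])
    ultimately show ?thesis
      by simp
  qed
  from this[of _ False] this[of _ True]
  have "\<forall>r\<ge>0. ((\<lambda>i. toward x (p i) r) \<longlongrightarrow> ray_from x (endpoint (g False 1)) r) U"
    "\<forall>r\<ge>0. ((\<lambda>i. toward x (q i) r) \<longlongrightarrow> ray_from x (endpoint (g True 1)) r) U"
    by (simp_all add: e_def)
  moreover have "endpoint (g b 1) \<in> visual_boundary" for b
    using ray[of b] endpoint_in_boundary by auto
  ultimately show ?thesis
    using U by (intro exI[of _ U] exI[of _ "endpoint (g False 1)"] exI[of _ "endpoint (g True 1)"]) simp
qed

end

subsection \<open>Joining irrational points to block boundaries\<close>

lemma continuous_on_real_steps:
  fixes f :: "real \<Rightarrow> 'b::topological_space"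
  assumes f: "\<And>n::nat. continuous_on {real n..real n + 1} f"
  shows "continuous_on {0..} f"
proof -
  have *: "continuous_on {0..real n} f" for n
  proof (induction n)
    case 0
    show ?case
      by simp
  next
    case (Suc n)
    have "{0..real n} \<union> {real n..real n + 1} = {0..real (Suc n)}"
      by auto
    then show ?case
      using continuous_on_closed_Un[OF closed_atLeastAtMost closed_atLeastAtMost Suc f[of n]] by simp
  qed
  \<comment> \<open>Infinitely many pieces glue along open sets only, so \<open>f\<close> is
    extended by its value at 0 and the line covered by open half-lines.\<close>
  have "continuous_on (\<Union>n. {..<real n}) (\<lambda>t. f (max 0 t))"
  proof (rule continuous_on_open_UN)
    fix n :: nat
    have "continuous_on {..<real n} (\<lambda>t. max 0 t)"
      by (intro continuous_intros)
    then show "continuous_on {..<real n} (\<lambda>t. f (max 0 t))"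
      by (rule continuous_on_compose2[OF *[of n]]) auto
  qed auto
  moreover have "(\<Union>n. {..<real n}) = UNIV"
    using reals_Archimedean2 by auto
  ultimately have "continuous_on {0..} (\<lambda>t. f (max 0 t))"
    by (metis continuous_on_subset subset_UNIV)
  then show ?thesis
    by (rule continuous_on_eq) simp
qed

lemma continuous_on_compactify:
  fixes \<phi> :: "real \<Rightarrow> 'b::metric_space"
  assumes \<phi>: "continuous_on {0..} \<phi>" and lim: "(\<phi> \<longlongrightarrow> l) at_top"
  shows "continuous_on {0..1} (\<lambda>t. if t < 1 then \<phi> (t / (1 - t)) else l)" (is "continuous_on _ ?k")
proof (rule continuous_onI)
  fix t e :: real assume t: "t \<in> {0..1}" and e: "0 < e"
  show "\<exists>d>0. \<forall>s\<in>{0..1}. dist s t < d \<longrightarrow> dist (?k s) (?k t) \<le> e"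
  proof (cases "t < 1")
    case True
    have "continuous_on {0..<1} (\<lambda>t. \<phi> (t / (1 - t)))"
      by (rule continuous_on_compose2[OF \<phi>]) (auto intro!: continuous_intros)
    then obtain d where d: "0 < d" "\<forall>s\<in>{0..<1}. dist s t < d \<longrightarrow> dist (\<phi> (s / (1 - s))) (\<phi> (t / (1 - t))) < e"
      using t True e unfolding continuous_on_iff by (metis atLeastAtMost_iff atLeastLessThan_iff)
    have "dist (?k s) (?k t) \<le> e" if "s \<in> {0..1}" "dist s t < min d (1 - t)" for s
    proof -
      have "s < 1"
        using that(2) by (simp add: dist_real_def abs_less_iff)
      then show ?thesis
        using d(2) that True by (auto intro: less_imp_le)
    qed
    then show ?thesis
      using d(1) True by (intro exI[of _ "min d (1 - t)"]) simp
  next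
    case False
    then have t1: "t = 1"
      using t by simp
    obtain T where T: "\<forall>s\<ge>T. dist (\<phi> s) l < e"
      using tendstoD[OF lim e] unfolding eventually_at_top_linorder by auto
    \<comment> \<open>For \<open>s < 1\<close>, \<open>s / (1 - s) \<ge> T'\<close> means
      \<open>1 - s \<le> 1 / (T' + 1)\<close>; this explains the radius below.\<close>
    define T' where "T' = max 0 T"
    have "dist (?k s) (?k t) \<le> e" if "s \<in> {0..1}" "dist s t < 1 / (T' + 1)" for s
    proof (cases "s < 1")
      case True
      have "1 - s < 1 / (T' + 1)"
        using that(2) True t1 by (simp add: dist_real_def)
      then have "(1 - s) * (T' + 1) < 1"
        by (simp add: T'_def pos_less_divide_eq)
      then have "T' * (1 - s) \<le> s"
        by (simp add: algebra_simps)
      then have "T' \<le> s / (1 - s)"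
        using True by (simp add: pos_le_divide_eq)
      then have "dist (\<phi> (s / (1 - s))) l < e"
        using T by (simp add: T'_def)
      then show ?thesis
        using True t1 by simp
    qed (use t1 e in simp)
    then show ?thesis
      by (intro exI[of _ "1 / (T' + 1)"]) (simp add: T'_def)
  qed
qed

context proper_CAT0
begin

text \<open>The path \<open>g n\<close> is run on \<open>[n, n + 1]\<close> and the half-line
  compressed to \<open>[0, 1)\<close>. Continuity at the end needs whole paths to converge to
  \<open>\<alpha>\<close>, not only the points \<open>w n\<close>, so \<open>lim\<close> is uniform
  in \<open>t\<close>.\<close>

lemma path_component_of_infinite_concatenation:
  fixes x :: 'a
  assumes g: "\<And>n. pathin (cone_topology x) (g n)" "\<And>n. g n 0 = w n" "\<And>n. g n 1 = w (Suc n)"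
    and \<alpha>: "\<alpha> \<in> visual_boundary"
    and lim: "\<And>r e. 0 < r \<Longrightarrow> 0 < e \<Longrightarrow>
      \<exists>N. \<forall>n\<ge>N. \<forall>t\<in>{0..1}. dist (ray_from x (g n t) r) (ray_from x \<alpha> r) < e"
  shows "path_component_of (cone_topology x) (w 0) \<alpha>"
proof -
  define h where "h t = g (nat \<lfloor>t\<rfloor>) (t - of_int \<lfloor>t\<rfloor>)" for t :: real
  have h_in: "\<exists>s\<in>{0..1}. h t = g (nat \<lfloor>t\<rfloor>) s" for t
  proof
    show "t - of_int \<lfloor>t\<rfloor> \<in> {0..1}"
      by (auto intro: less_imp_le) linarith
  qed (simp add: h_def)
  have h_eq: "h t = g n (t - real n)" if "t \<in> {real n..real n + 1}" for n t
  \<comment> \<open>At the right end the floor has already jumped to \<open>Suc n\<close>; the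
    values agree because consecutive paths share \<open>w (Suc n)\<close>.\<close>
  proof (cases "t = real n + 1")
    case True
    then have "\<lfloor>t\<rfloor> = int (Suc n)"
      by simp
    then show ?thesis
      using True g(2)[of "Suc n"] g(3)[of n] by (simp add: h_def nat_add_distrib)
  next
    case False
    then have "\<lfloor>t\<rfloor> = int n"
      using that by (intro floor_unique) auto
    then show ?thesis
      by (simp add: h_def)
  qed
  have pg: "g n \<in> {0..1} \<rightarrow> visual_boundary"
    "0 < r \<Longrightarrow> continuous_on {0..1} (\<lambda>t. ray_from x (g n t) r)" for n r
    using g(1)[of n] unfolding pathin_cone_topology by simp_all
  have h_bd: "h t \<in> visual_boundary" for t
    using h_in[of t] funcset_mem[OF pg(1)] by metis
  define k where "k t = (if t < 1 then h (t / (1 - t)) else \<alpha>)" for t :: real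
  have "pathin (cone_topology x) k"
    unfolding pathin_cone_topology
  proof (intro conjI allI impI)
    show "k \<in> {0..1} \<rightarrow> visual_boundary"
      using h_bd \<alpha> by (simp add: k_def)
    fix r :: real assume r: "0 < r"
    have "continuous_on {0..} (\<lambda>t. ray_from x (h t) r)"
    proof (rule continuous_on_real_steps)
      fix n :: nat
      have "continuous_on {real n..real n + 1} (\<lambda>t. t - real n)"
        by (intro continuous_intros)
      then have "continuous_on {real n..real n + 1} (\<lambda>t. ray_from x (g n (t - real n)) r)"
        by (rule continuous_on_compose2[OF pg(2)[OF r]]) auto
      then show "continuous_on {real n..real n + 1} (\<lambda>t. ray_from x (h t) r)"
        by (rule continuous_on_eq) (simp add: h_eq)
    qed
    moreover have "((\<lambda>t. ray_from x (h t) r) \<longlongrightarrow> ray_from x \<alpha> r) at_top"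
    proof (rule tendstoI)
      fix e :: real assume e: "0 < e"
      obtain N where N: "\<forall>n\<ge>N. \<forall>t\<in>{0..1}. dist (ray_from x (g n t) r) (ray_from x \<alpha> r) < e"
        using lim[OF r e] by auto
      show "\<forall>\<^sub>F t in at_top. dist (ray_from x (h t) r) (ray_from x \<alpha> r) < e"
        using eventually_ge_at_top[of "real N"]
      proof eventually_elim
        case (elim t)
        then have "N \<le> nat \<lfloor>t\<rfloor>"
          by (simp add: le_nat_floor)
        then show ?case
          using N h_in[of t] by auto
      qed
    qed
    ultimately have "continuous_on {0..1} (\<lambda>t. if t < 1 then ray_from x (h (t / (1 - t))) r else ray_from x \<alpha> r)"
      by (rule continuous_on_compactify)
    then show "continuous_on {0..1} (\<lambda>t. ray_from x (k t) r)"
      by (rule continuous_on_eq) (simp add: k_def)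
  qed
  moreover have "k 0 = w 0" "k 1 = \<alpha>"
    using g(2)[of 0] by (simp_all add: k_def h_def)
  ultimately show ?thesis
    unfolding path_component_of_def by (intro exI[of _ k]) simp
qed

end

section \<open>Paths through block and wall boundaries\<close>

lemma boundary_of_mono: "C \<subseteq> D \<Longrightarrow> boundary_of C \<subseteq> boundary_of D"
  by (auto simp: boundary_of_def)

lemma path_component_of_path_connectedin:
  assumes "path_connectedin T S" "a \<in> S" "b \<in> S"
  shows "path_component_of T a b"
proof -
  have "\<exists>g. pathin T g \<and> g \<in> {0..1} \<rightarrow> S \<and> g 0 = a \<and> g 1 = b"
    using assms unfolding path_connectedin by simp
  then obtain g where "pathin T g" "g 0 = a" "g 1 = b"
    by (elim exE conjE)
  then show ?thesis
    unfolding path_component_of_def by (intro exI[of _ g] conjI)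
qed

context block_decomposed
begin

context
  assumes block_boundary: "\<And>B. B \<in> \<B> \<Longrightarrow> path_connectedin (cone_topology x0) (boundary_of B)"
    and wall_boundary: "\<And>W. W \<in> walls \<B> \<Longrightarrow> boundary_of W \<noteq> {}"
begin

lemma block_boundaries_connected:
  assumes B: "B \<in> \<B>" "\<beta> \<in> boundary_of B" and D: "D \<in> \<B>" "\<delta> \<in> boundary_of D"
  shows "path_component_of (cone_topology x0) \<beta> \<delta>"
proof -
  let ?T = "cone_topology x0"
  define S where "S = {E \<in> \<B>. \<forall>\<epsilon>\<in>boundary_of E. path_component_of ?T \<beta> \<epsilon>}"
  have BS: "B \<in> S"
    using path_component_of_path_connectedin[OF block_boundary] B by (simp add: S_def)
  have step: "F \<in> S" if E: "E \<in> S" and F: "F \<in> \<B>" and y: "y \<in> E" "y \<in> F" for E F y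
  proof (cases "E = F")
    case False
    have "E \<inter> F \<in> walls \<B>"
      using E F y False unfolding walls_def S_def by auto
    then obtain \<omega> where "\<omega> \<in> boundary_of (E \<inter> F)"
      using wall_boundary by (metis ex_in_conv)
    then have \<omega>: "\<omega> \<in> boundary_of E" "\<omega> \<in> boundary_of F"
      using boundary_of_mono[of "E \<inter> F" E] boundary_of_mono[of "E \<inter> F" F] by auto
    have "path_component_of ?T \<beta> \<omega>"
      using E \<omega>(1) by (simp add: S_def)
    then have "path_component_of ?T \<beta> \<phi>" if "\<phi> \<in> boundary_of F" for \<phi>
      using path_component_of_trans path_component_of_path_connectedin[OF block_boundary[OF F] \<omega>(2) that]
      by metis
    then show ?thesis
      using F by (simp add: S_def)
  qed (use E in simp)
  \<comment> \<open>Points close to \<open>y\<close> lie only in blocks through \<open>y\<close>,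
    and \<open>step\<close> puts all of these into \<open>S\<close> as soon as one is. So the union
    of \<open>S\<close> is open and closed.\<close>
  have covered: "(\<exists>E\<in>S. y \<in> E) = (\<exists>E\<in>S. z \<in> E)" for y z
  proof (rule connected_local_const[where A = UNIV and f = "\<lambda>y. \<exists>E\<in>S. y \<in> E"])
    show "connected (UNIV :: 'a set)"
      by (rule connected_convex) (simp add: geodesically_convex_def)
    show "\<forall>y\<in>UNIV. \<forall>\<^sub>F z in at y. (\<exists>E\<in>S. y \<in> E) = (\<exists>E\<in>S. z \<in> E)"
    proof
      fix y :: 'a
      obtain \<rho> where \<rho>: "0 < \<rho>" "\<forall>C\<in>\<B>. \<forall>z\<in>C. dist y z < \<rho> \<longrightarrow> y \<in> C"
        using near_blocks_contain_center[of y] by auto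
      have "(\<exists>E\<in>S. y \<in> E) = (\<exists>E\<in>S. z \<in> E)" if "dist z y < \<rho>" for z
      proof
        assume "\<exists>E\<in>S. y \<in> E"
        then obtain E where E: "E \<in> S" "y \<in> E"
          by auto
        obtain F where F: "F \<in> \<B>" "z \<in> F"
          using cover by auto
        have "y \<in> F"
          by (rule \<rho>(2)[rule_format, OF F]) (use that in \<open>simp add: dist_commute\<close>)
        from step[OF E(1) F(1) E(2) this] F(2) show "\<exists>E\<in>S. z \<in> E"
          by auto
      next
        assume "\<exists>E\<in>S. z \<in> E"
        then obtain E where E: "E \<in> S" "z \<in> E"
          by auto
        then have "E \<in> \<B>"
          by (simp add: S_def)
        have "y \<in> E"
          by (rule \<rho>(2)[rule_format, OF \<open>E \<in> \<B>\<close> E(2)]) (use that in \<open>simp add: dist_commute\<close>)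
        with E show "\<exists>E\<in>S. y \<in> E"
          by auto
      qed
      then show "\<forall>\<^sub>F z in at y. (\<exists>E\<in>S. y \<in> E) = (\<exists>E\<in>S. z \<in> E)"
        unfolding eventually_at using \<rho>(1) by (intro exI[of _ \<rho>]) simp
    qed
  qed auto
  obtain b d where b: "b \<in> B" and d: "d \<in> D"
    using block_nonempty B(1) D(1) by (metis ex_in_conv)
  have "\<exists>E\<in>S. b \<in> E"
    using b BS by auto
  then obtain E where E: "E \<in> S" "d \<in> E"
    using covered by auto
  have "D \<in> S"
    by (rule step[OF E(1) D(1) E(2) d])
  then show ?thesis
    using D(2) by (simp add: S_def)
qed

lemma irrational_joined_to_block_boundary:
  assumes \<alpha>: "\<alpha> \<in> visual_boundary" "irrational \<B> x0 \<alpha>" "lonely \<B> x0 \<alpha>"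
  shows "\<exists>B\<in>\<B>. \<exists>\<beta>\<in>boundary_of B. path_component_of (cone_topology x0) \<beta> \<alpha>"
proof -
  let ?T = "cone_topology x0" and ?c = "ray_from x0 \<alpha>"
  obtain Bs where Bs: "block_chain Bs" and it: "boundary_itinerary \<B> x0 \<alpha> = (\<lambda>n. Some (Bs n))"
    and sole: "\<forall>n. \<exists>t\<ge>0. sole (?c t) (Bs n)"
    using irrational_chain[OF \<alpha>(1,2)] by (elim exE conjE)
  note block = block_chainD(2)[OF Bs]
  note ray = ray_from(3,2)[OF \<alpha>(1), of x0]
  show ?thesis
  proof (cases "\<forall>r>0. \<forall>e>0. \<exists>N. \<forall>n\<ge>N. \<forall>\<beta>\<in>boundary_of (Bs n). dist (ray_from x0 \<beta> r) (?c r) < e")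
    case True
    have "boundary_of (Bs n \<inter> Bs (Suc n)) \<noteq> {}" for n
    proof (rule wall_boundary)
      obtain z where z: "z \<in> Bs (Suc n)"
        using block_nonempty[OF block] by (metis ex_in_conv)
      note B = block block_chainD(3)[OF Bs] z
      have "toward x0 z (entry_time (Bs (Suc n)) z) \<in> Bs n \<inter> Bs (Suc n)"
        using parent_props(3)[OF B] entry_time_props(1,3)[OF B] block_chainD(4)[OF Bs, of n] by simp
      moreover have "Bs n \<noteq> Bs (Suc n)"
        using parent_props(2)[OF B] block_chainD(4)[OF Bs, of n] by simp
      ultimately show "Bs n \<inter> Bs (Suc n) \<in> walls \<B>"
        unfolding walls_def using block by (metis (mono_tags, lifting) empty_iff mem_Collect_eq)
    qed
    then have "\<exists>w. \<forall>n. w n \<in> boundary_of (Bs n \<inter> Bs (Suc n))"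
      by (intro choice) (metis ex_in_conv)
    then obtain w where w: "\<forall>n. w n \<in> boundary_of (Bs n \<inter> Bs (Suc n))" ..
    have w1: "w n \<in> boundary_of (Bs n)" and w2: "w n \<in> boundary_of (Bs (Suc n))" for n
      using w[rule_format, of n] boundary_of_mono[of "Bs n \<inter> Bs (Suc n)" "Bs n"]
        boundary_of_mono[of "Bs n \<inter> Bs (Suc n)" "Bs (Suc n)"] by auto
    \<comment> \<open>The walls carrying \<open>w n\<close> and \<open>w (Suc n)\<close> are both
      contained in \<open>Bs (Suc n)\<close>, whence the shifted index.\<close>
    have "\<exists>g. \<forall>n. pathin ?T (g n) \<and> g n \<in> {0..1} \<rightarrow> boundary_of (Bs (Suc n)) \<and> g n 0 = w n \<and> g n 1 = w (Suc n)"
    proof (intro choice allI)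
      fix n
      show "\<exists>g. pathin ?T g \<and> g \<in> {0..1} \<rightarrow> boundary_of (Bs (Suc n)) \<and> g 0 = w n \<and> g 1 = w (Suc n)"
        using block_boundary[OF block[of "Suc n"]] w2[of n] w1[of "Suc n"] unfolding path_connectedin by simp
    qed
    then obtain g where g: "\<forall>n. pathin ?T (g n) \<and> g n \<in> {0..1} \<rightarrow> boundary_of (Bs (Suc n)) \<and>
      g n 0 = w n \<and> g n 1 = w (Suc n)" ..
    have "path_component_of ?T (w 0) \<alpha>"
    proof (rule path_component_of_infinite_concatenation[where g = g])
      fix r e :: real assume re: "0 < r" "0 < e"
      obtain N where N: "\<forall>n\<ge>N. \<forall>\<beta>\<in>boundary_of (Bs n). dist (ray_from x0 \<beta> r) (?c r) < e"
        using True[rule_format, OF re] ..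
      have "dist (ray_from x0 (g n t) r) (?c r) < e" if "N \<le> n" "t \<in> {0..1}" for n t
      proof -
        have "g n \<in> {0..1} \<rightarrow> boundary_of (Bs (Suc n))"
          using g by simp
        then have "g n t \<in> boundary_of (Bs (Suc n))"
          using that(2) by (rule funcset_mem)
        then show ?thesis
          by (rule N[rule_format, rotated]) (use that(1) in simp)
      qed
      then show "\<exists>N. \<forall>n\<ge>N. \<forall>t\<in>{0..1}. dist (ray_from x0 (g n t) r) (?c r) < e"
        by (intro exI[of _ N]) simp
    qed (use g \<alpha>(1) in auto)
    then show ?thesis
      using w1[of 0] block[of 0] by auto
  next
    case False
    then obtain r e where r: "0 < r" and e: "0 < e" and
      away: "\<forall>N. \<exists>n\<ge>N. \<exists>\<beta>\<in>boundary_of (Bs n). e \<le> dist (ray_from x0 \<beta> r) (?c r)"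
      by (auto simp: not_less)
    \<comment> \<open>A boundary point is replaced by a point \<open>q\<close> of the block far out
      on a representing ray; half of \<open>e\<close> pays for the approximation.\<close>
    have "\<exists>n q. i \<le> n \<and> q \<in> Bs n \<and> e / 2 \<le> dist (toward x0 q r) (?c r)" for i
    proof -
      obtain n \<beta> where n: "i \<le> n" "\<beta> \<in> boundary_of (Bs n)" "e \<le> dist (ray_from x0 \<beta> r) (?c r)"
        using away[rule_format, of i] by (elim exE bexE conjE)
      then obtain d where \<beta>: "\<beta> \<in> visual_boundary" and d: "d \<in> \<beta>" "d ` {0..} \<subseteq> Bs n"
        unfolding boundary_of_def by auto
      have "eventually (\<lambda>s. dist (toward x0 (d s) r) (ray_from x0 \<beta> r) < e / 2) at_top"
        using tendstoD[OF toward_tendsto_ray_from[OF \<beta> d(1)], of r "e / 2" x0] r e by simp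
      then have "eventually (\<lambda>s. 0 \<le> s \<and> dist (toward x0 (d s) r) (ray_from x0 \<beta> r) < e / 2) at_top"
        using eventually_ge_at_top[of 0] by eventually_elim simp
      then obtain s where s: "0 \<le> s" "dist (toward x0 (d s) r) (ray_from x0 \<beta> r) < e / 2"
        unfolding eventually_at_top_linorder by auto
      have "e / 2 \<le> dist (toward x0 (d s) r) (?c r)"
        using dist_triangle[of "ray_from x0 \<beta> r" "?c r" "toward x0 (d s) r"] s(2) n(3) by (simp add: dist_commute)
      moreover have "d s \<in> Bs n"
        using d(2) s(1) by auto
      ultimately show ?thesis
        using n(1) by auto
    qed
    then obtain N q where q: "\<And>i. i \<le> N i" "\<And>i. q i \<in> Bs (N i)" "\<And>i. e / 2 \<le> dist (toward x0 (q i) r) (?c r)"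
      by metis
    obtain \<tau> where \<tau>: "\<And>n. 0 \<le> \<tau> n" "\<And>n. sole (?c (\<tau> n)) (Bs n)"
      using sole by metis
    \<comment> \<open>These points lie on the ray of \<open>\<alpha>\<close> itself, so their
      directions converge to \<open>\<alpha>\<close>, while those of \<open>q i\<close> stay away
      from it at radius \<open>r\<close>.\<close>
    define p where "p i = ?c (\<tau> (N i))" for i
    have p: "p i \<in> Bs (N i)" for i
      unfolding p_def by (rule sole_in(2)[OF \<tau>(2)])
    have "filterlim N sequentially sequentially"
      by (rule filterlim_at_top_mono[OF filterlim_ident]) (simp add: q(1))
    then have far: "eventually (\<lambda>i. Bs (N i) \<inter> cball x0 s = {}) sequentially" for s
      by (rule eventually_compose_filterlim[OF block_chain_far[OF Bs]])
    obtain U \<xi> \<eta> where U: "U \<noteq> bot" "U \<le> sequentially" and bd: "\<xi> \<in> visual_boundary" "\<eta> \<in> visual_boundary"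
      and \<xi>: "\<forall>r\<ge>0. ((\<lambda>i. toward x0 (p i) r) \<longlongrightarrow> ray_from x0 \<xi> r) U"
      and \<eta>: "\<forall>r\<ge>0. ((\<lambda>i. toward x0 (q i) r) \<longlongrightarrow> ray_from x0 \<eta> r) U"
      and path: "path_component_of ?T \<xi> \<eta>"
      using limits_from_receding_convex_sets[of "\<lambda>i. Bs (N i)" p q x0,
          OF closed_block[OF block] convex_block[OF block] p q(2) far] by (elim exE conjE)
    have "\<xi> = \<alpha>"
    proof (rule boundary_eqI[OF bd(1) \<alpha>(1)])
      fix t :: real assume t: "0 \<le> t"
      have "eventually (\<lambda>i. toward x0 (p i) t = ?c t) sequentially"
        using far[of t]
      proof eventually_elim
        case (elim i)
        then have "p i \<notin> cball x0 t"
          using p[of i] by auto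
        moreover have "dist x0 (p i) = \<tau> (N i)"
          using geodesic_ray_dist[OF ray(1), of 0 "\<tau> (N i)"] ray(2) \<tau>(1) by (simp add: p_def)
        ultimately show ?case
          using toward_ray[OF ray(1) t \<tau>(1), of "N i"] ray(2) by (simp add: p_def min_def)
      qed
      then have "eventually (\<lambda>i. toward x0 (p i) t = ?c t) U"
        by (rule filter_leD[OF U(2)])
      then have "((\<lambda>i. toward x0 (p i) t) \<longlongrightarrow> ?c t) U"
        by (rule tendsto_eventually)
      then show "ray_from x0 \<xi> t = ?c t"
        using tendsto_unique[OF U(1)] \<xi> t by metis
    qed
    have "e / 2 \<le> dist (ray_from x0 \<eta> r) (?c r)"
    proof (rule tendsto_lowerbound[OF _ _ U(1)])
      show "((\<lambda>i. dist (toward x0 (q i) r) (?c r)) \<longlongrightarrow> dist (ray_from x0 \<eta> r) (?c r)) U"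
        using \<eta> r by (intro tendsto_dist tendsto_const) simp
    qed (intro always_eventually allI q(3))
    then have "\<eta> \<noteq> \<alpha>"
      using e by auto
    have "\<not> irrational \<B> x0 \<eta>"
    proof
      assume irr: "irrational \<B> x0 \<eta>"
      have "boundary_itinerary \<B> x0 \<eta> = (\<lambda>n. Some (Bs n))"
        by (rule limit_itinerary[where q = q and N = N, OF Bs bd(2) irr U(1) q(2)]) (use \<eta> in simp)
      then show False
        using \<alpha>(3) bd(2) \<open>\<eta> \<noteq> \<alpha>\<close> it unfolding lonely_def by simp
    qed
    then obtain B where "B \<in> \<B>" "\<eta> \<in> boundary_of B"
      using rational_in_block_boundary[OF bd(2)] by auto
    then show ?thesis
      using path \<open>\<xi> = \<alpha>\<close> path_component_of_sym[of ?T \<xi> \<eta>] by auto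
  qed
qed

end

end

theorem theorem6p19:
  fixes \<B> :: "'a::metric_space set set" and x0 :: 'a
  assumes "proper_metric_space TYPE('a)"
    and "CAT0_space TYPE('a)"
    and "block_decomposition \<B>"
    and "x0 \<notin> \<Union>(walls \<B>)"
    and "\<And>B. B \<in> \<B> \<Longrightarrow> path_connectedin (cone_topology x0) (boundary_of B)"
    and "\<And>W. W \<in> walls \<B> \<Longrightarrow> boundary_of W \<noteq> {}"
    and "\<And>\<alpha>. \<alpha> \<in> visual_boundary \<Longrightarrow> irrational \<B> x0 \<alpha> \<Longrightarrow> lonely \<B> x0 \<alpha>"
  shows "path_connectedin (cone_topology x0) visual_boundary"
proof -
  interpret block_decomposed "TYPE('a)" \<B> x0
    using assms(1-4) by unfold_locales
  let ?T = "cone_topology x0"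
  have joined: "\<exists>B\<in>\<B>. \<exists>\<beta>\<in>boundary_of B. path_component_of ?T \<beta> \<alpha>" if \<alpha>: "\<alpha> \<in> visual_boundary" for \<alpha>
  proof (cases "irrational \<B> x0 \<alpha>")
    case True
    from irrational_joined_to_block_boundary[OF assms(5,6) \<alpha> True assms(7)[OF \<alpha> True]] show ?thesis
      by simp
  next
    case False
    then obtain B where "B \<in> \<B>" "\<alpha> \<in> boundary_of B"
      using rational_in_block_boundary[OF \<alpha>] by auto
    moreover have "path_component_of ?T \<alpha> \<alpha>"
      using \<alpha> by (simp add: path_component_of_refl topspace_cone_topology)
    ultimately show ?thesis
      by auto
  qed
  have "path_component_of ?T \<alpha> \<beta>" if \<alpha>: "\<alpha> \<in> visual_boundary" and \<beta>: "\<beta> \<in> visual_boundary" for \<alpha> \<beta>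
  proof -
    obtain B \<alpha>' where B: "B \<in> \<B>" "\<alpha>' \<in> boundary_of B" "path_component_of ?T \<alpha>' \<alpha>"
      using joined[OF \<alpha>] by auto
    obtain D \<beta>' where D: "D \<in> \<B>" "\<beta>' \<in> boundary_of D" "path_component_of ?T \<beta>' \<beta>"
      using joined[OF \<beta>] by auto
    have "path_component_of ?T \<alpha>' \<beta>'"
      by (rule block_boundaries_connected[OF assms(5,6) B(1,2) D(1,2)])
    with path_component_of_sym[OF B(3)] D(3) show ?thesis
      using path_component_of_trans by metis
  qed
  then have "path_connected_space ?T"
    unfolding path_connected_space_def topspace_cone_topology path_component_of_def by simp
  then show ?thesis
    using path_connectedin_topspace[of ?T] by (simp add: topspace_cone_topology)
qed

end
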